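(* Let $N$ be a positive integer and let $a,b\in\mathbb{R}$ satisfy $0\le b<\frac{N-2}{2}$, $a\le \frac{Nb}{N-2}$ and $a+b+1=\frac{2bN}{N-2}$. There exists a constant $C(N,a,b)>0$, depending only on $N,a,b$, such that for all $u\in X_{a,b}$, $$\left(\int_{\mathbb{R}^N}\frac{|u|^2}{|x|^{2a}}\,dx\right)^{\frac12}\left(\int_{\mathbb{R}^N}\frac{|\nabla u|^2}{|x|^{2b}}\,dx\right)^{\frac12}-\left|\frac{N-a-b-1}{2}\right|\int_{\mathbb{R}^N}\frac{|u|^2}{|x|^{a+b+1}}\,dx\ \ge\ C(N,a,b)\,\inf\int_{\mathbb{R}^N}\frac{\left|u-\alpha\exp\left(-\frac{\beta}{b+1-a}|x|^{b+1-a}\right)\right|^2}{|x|^{a+b+1}}\,dx,$$ where the infimum is taken over all $\alpha\in\mathbb{R}$ and $\beta>0$ such that $$\int_{\mathbb{R}^N}\frac{|u|^2}{|x|^{a+b+1}}\,dx=\int_{\mathbb{R}^N}\frac{\left|\alpha\exp\left(-\frac{\beta}{b+1-a}|x|^{b+1-a}\right)\right|^2}{|x|^{a+b+1}}\,dx.$$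
   Context: All functions are real-valued. $X_{a,b}$ denotes the completion of $C_0^\infty(\mathbb{R}^N)$ under the norm $\left(\int_{\mathbb{R}^N}\frac{|\nabla u|^2}{|x|^{2b}}dx+\int_{\mathbb{R}^N}\frac{|u|^2}{|x|^{2a}}dx\right)^{1/2}$. *)

theory Defs
  imports "HOL-Analysis.Analysis"
begin

definition partial_deriv :: "'n::finite \<Rightarrow> (real ^ 'n \<Rightarrow> real) \<Rightarrow> real ^ 'n \<Rightarrow> real" where
  "partial_deriv i f x = frechet_derivative f (at x) (axis i 1)"

definition gradient :: "(real ^ 'n \<Rightarrow> real) \<Rightarrow> real ^ 'n \<Rightarrow> real ^ 'n::finite" where
  "gradient f x = (\<chi> i. partial_deriv i f x)"

primrec C_k :: "nat \<Rightarrow> (real ^ 'n::finite \<Rightarrow> real) \<Rightarrow> bool" where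
  "C_k 0 f \<longleftrightarrow> continuous_on UNIV f"
| "C_k (Suc k) f \<longleftrightarrow> (\<forall>x. f differentiable (at x)) \<and> (\<forall>i. C_k k (partial_deriv i f))"

definition test_functions :: "(real ^ 'n::finite \<Rightarrow> real) set" where
  "test_functions = {f. (\<forall>k. C_k k f) \<and> compact (closure {x. f x \<noteq> 0})}"

definition X_norm_sq ::
    "real \<Rightarrow> real \<Rightarrow> (real ^ 'n \<Rightarrow> real) \<Rightarrow> (real ^ 'n \<Rightarrow> real ^ 'n::finite) \<Rightarrow> ennreal" where
  "X_norm_sq a b u Du =
     (\<integral>\<^sup>+x. ennreal ((norm (Du x))\<^sup>2 / norm x powr (2 * b)) \<partial>lebesgue) +
     (\<integral>\<^sup>+x. ennreal (\<bar>u x\<bar>\<^sup>2 / norm x powr (2 * a)) \<partial>lebesgue)"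

text \<open>
  The completion of the test functions is realised concretely, as the closure of
  the graph of the gradient, i.e. of all pairs of a test function and its gradient,
  in the complete space of pairs \<open>(u, Du)\<close> of measurable functions with finite
  \<open>X_norm_sq\<close> (functions that agree almost everywhere are not identified).
  In a pair \<open>(u, Du)\<close> of this space, \<open>Du\<close> is the gradient of \<open>u\<close>.
  When \<open>0 \<le> b\<close>, \<open>2 * a < N\<close> and \<open>2 * b < N\<close>, all test functions have finite norm
  and \<open>Du\<close> is determined by \<open>u\<close> almost everywhere: it is the weak gradient of \<open>u\<close>
  away from the origin.
\<close>
definition X_space :: "real \<Rightarrow> real \<Rightarrow> ((real ^ 'n \<Rightarrow> real) \<times> (real ^ 'n \<Rightarrow> real ^ 'n::finite)) set" where
  "X_space a b = {(u, Du).
     u \<in> borel_measurable lebesgue \<and> Du \<in> borel_measurable lebesgue \<and>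
     X_norm_sq a b u Du < \<infinity> \<and>
     (\<exists>\<phi>. (\<forall>k. \<phi> k \<in> test_functions) \<and>
        (\<lambda>k. X_norm_sq a b (\<lambda>x. u x - \<phi> k x) (\<lambda>x. Du x - gradient (\<phi> k) x)) \<longlonglongrightarrow> 0)}"

definition extremal :: "real \<Rightarrow> real \<Rightarrow> real \<Rightarrow> real \<Rightarrow> real ^ 'n::finite \<Rightarrow> real" where
  "extremal a b \<alpha> \<beta> x = \<alpha> * exp (- (\<beta> / (b + 1 - a)) * norm x powr (b + 1 - a))"

end

theory Submission
  imports Defs
begin

text \<open>
  Put \<open>\<kappa> = (N - 2) / (N - 2 - 2 b)\<close> and substitute \<open>x = |y| powr (\<kappa> - 1) y\<close>. The
  weight \<open>|x| powr - (a + b + 1)\<close> becomes constant, the extremals become Gaussians, and the weighted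
  Dirichlet energy dominates a multiple of the unweighted one. Completing the square, with an
  integration by parts that only uses invariance under dilations, writes
  \<open>B / \<beta> + \<beta> A - (N - a - b - 1) G\<close> as a weighted energy of \<open>u\<close> divided by the extremal with parameter
  \<open>\<beta>\<close>; here \<open>A\<close>, \<open>B\<close>, \<open>G\<close> are the integrals of \<open>u\<close>, of its gradient and of \<open>u\<close> with the weights
  of exponent \<open>2 a\<close>, \<open>2 b\<close> and \<open>a + b + 1\<close>. The Gaussian Poincare inequality bounds this below by the
  squared distance of \<open>u\<close> to the line spanned by that extremal. Finally \<open>\<beta> = sqrt (B / A)\<close> turns the
  left-hand side into twice the deficit, and rescaling the projection to the norm of \<open>u\<close> costs at most
  a factor 2.
\<close>

section \<open>Dilations and radial changes of variables\<close>

text \<open>With t = 2 b / (N - 2) the relation between a and b says 2 b = (N - 2) t, a + b + 1 = N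
  t and 2 a = (N + 2) t - 2. One parameter thus governs all three weights; 1 / \<kappa> = 1 - t is
  the choice that flattens the middle one, and then b + 1 - a = 2 / \<kappa>. From b \<ge> 0 comes
  \<kappa> \<ge> 1, so the radial direction is the one stretched most. The origin shapes the proof:
  weights may be singular there, and the substitution is differentiated only away from it. Hence the
  Poincare inequality is proved for continuous functions that are differentiable off the origin. The
  squared distance to a line is carried as the double integral of (u(x) g(y) - u(y) g(x))^2. This
  involves no projection, fits a Poincare inequality over pairs, and is lower semicontinuous.
  Finiteness of G is not known beforehand, so estimates are sums in \<open>ennreal\<close> without
  subtraction until G has been bounded. The constant must not depend on \<beta>: scaling the
  Gaussian turns its second moment over its mass into a multiple of 1 / \<beta>, exactly the
  normalisation of the completed square.\<close>

lemma nn_integral_lborel_dilation: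
  fixes h :: "'a::euclidean_space \<Rightarrow> ennreal"
  assumes [measurable]: "h \<in> borel_measurable borel" and t: "t \<noteq> 0"
  shows "(\<integral>\<^sup>+x. h x \<partial>lborel) = ennreal (\<bar>t\<bar> ^ DIM('a)) * (\<integral>\<^sup>+x. h (t *\<^sub>R x) \<partial>lborel)"
proof -
  have "(\<integral>\<^sup>+x. h x \<partial>lborel) = (\<integral>\<^sup>+x. h x \<partial>density (distr lborel borel (\<lambda>x. 0 + t *\<^sub>R x)) (\<lambda>_. \<bar>t\<bar> ^ DIM('a)))"
    using lborel_affine[OF t, of "0::'a"] by simp
  then show ?thesis
    by (simp add: nn_integral_density nn_integral_distr nn_integral_cmult)
qed

lemma nn_integral_lborel_translation:
  fixes h :: "'a::euclidean_space \<Rightarrow> ennreal"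
  assumes [measurable]: "h \<in> borel_measurable borel"
  shows "(\<integral>\<^sup>+x. h (x + c) \<partial>lborel) = (\<integral>\<^sup>+x. h x \<partial>lborel)"
proof -
  have "(\<integral>\<^sup>+x. h x \<partial>lborel) = (\<integral>\<^sup>+x. h x \<partial>distr lborel borel ((+) c))"
    using lborel_distr_plus[of c] by simp
  then show ?thesis
    by (simp add: nn_integral_distr add.commute)
qed

text \<open>A substitute for polar coordinates. The density |x| powr (- DIM) is invariant under
  dilations, and the shell 1 \<le> |x| \<le> e meets every dilation orbit in logarithmic length 1,
  so it serves as a cross-section over which orbit integrals are collected.\<close>

lemma nn_integral_dilation_average:
  fixes h :: "'a::euclidean_space \<Rightarrow> ennreal"
  assumes [measurable]: "h \<in> borel_measurable borel"
  shows "(\<integral>\<^sup>+x. h x * ennreal (norm x powr - real DIM('a)) \<partial>lborel) =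
    (\<integral>\<^sup>+x. indicator {0..1} (ln (norm x)) * ennreal (norm x powr - real DIM('a)) *
       (\<integral>\<^sup>+s. h (exp s *\<^sub>R x) \<partial>lborel) \<partial>lborel)"
proof -
  let ?w = "\<lambda>x::'a. ennreal (norm x powr - real DIM('a))"
  let ?k = "\<lambda>t::real. indicator {0..1} t :: ennreal"
  have k1: "(\<integral>\<^sup>+s. ?k (r - s) \<partial>lborel) = 1" for r :: real
  proof -
    have "(\<integral>\<^sup>+s. ?k (r - s) \<partial>lborel) = (\<integral>\<^sup>+s. ?k (r + (-1) *\<^sub>R s) \<partial>lborel)" by simp
    also have "\<dots> = (\<integral>\<^sup>+s. ?k (r + s) \<partial>lborel)"
      using nn_integral_lborel_dilation[of "\<lambda>s. ?k (r + s)" "-1"] by simp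
    also have "\<dots> = (\<integral>\<^sup>+s. ?k s \<partial>lborel)"
      using nn_integral_lborel_translation[of ?k r] by (simp add: add.commute)
    finally show ?thesis by simp
  qed
  \<comment> \<open>Insert the factor 1 provided by \<open>k1\<close>. After Fubini the dilation by
    \<open>exp s\<close> is substituted for each fixed \<open>s\<close>; its Jacobian cancels
    against the weight.\<close>
  have "(\<integral>\<^sup>+x. h x * ?w x \<partial>lborel) = (\<integral>\<^sup>+x. (\<integral>\<^sup>+s. h x * ?w x * ?k (ln (norm x) - s) \<partial>lborel) \<partial>lborel)"
    by (simp add: nn_integral_cmult k1)
  also have "\<dots> = (\<integral>\<^sup>+s. (\<integral>\<^sup>+x. h x * ?w x * ?k (ln (norm x) - s) \<partial>lborel) \<partial>lborel)"
    by (rule lborel_pair.Fubini') measurable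
  also have "\<dots> = (\<integral>\<^sup>+s. (\<integral>\<^sup>+x. h (exp s *\<^sub>R x) * ?w x * ?k (ln (norm x)) \<partial>lborel) \<partial>lborel)"
  proof (rule nn_integral_cong)
    fix s :: real
    have *: "ennreal (exp s ^ DIM('a)) * (h (exp s *\<^sub>R x) * ?w (exp s *\<^sub>R x) * ?k (ln (norm (exp s *\<^sub>R x)) - s))
       = h (exp s *\<^sub>R x) * ?w x * ?k (ln (norm x))" if "x \<noteq> 0" for x
    proof -
      have "exp s ^ DIM('a) * norm (exp s *\<^sub>R x) powr - real DIM('a) = norm x powr - real DIM('a)"
        using that by (simp add: powr_mult powr_minus powr_realpow field_simps)
      then have "ennreal (exp s ^ DIM('a)) * ?w (exp s *\<^sub>R x) = ?w x"
        by (simp flip: ennreal_mult)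
      then have "ennreal (exp s ^ DIM('a)) * (H * ?w (exp s *\<^sub>R x) * K) = H * ?w x * K" for H K
        by (metis mult.assoc mult.commute)
      moreover have "ln (norm (exp s *\<^sub>R x)) - s = ln (norm x)"
        using that by (simp add: ln_mult)
      ultimately show ?thesis
        by (simp only:)
    qed
    have "(\<integral>\<^sup>+x. h x * ?w x * ?k (ln (norm x) - s) \<partial>lborel) =
       ennreal (\<bar>exp s\<bar> ^ DIM('a)) * (\<integral>\<^sup>+x. h (exp s *\<^sub>R x) * ?w (exp s *\<^sub>R x) * ?k (ln (norm (exp s *\<^sub>R x)) - s) \<partial>lborel)"
      by (rule nn_integral_lborel_dilation) auto
    also have "\<dots> = (\<integral>\<^sup>+x. ennreal (exp s ^ DIM('a)) * (h (exp s *\<^sub>R x) * ?w (exp s *\<^sub>R x) * ?k (ln (norm (exp s *\<^sub>R x)) - s)) \<partial>lborel)"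
      by (subst nn_integral_cmult) auto
    also have "\<dots> = (\<integral>\<^sup>+x. h (exp s *\<^sub>R x) * ?w x * ?k (ln (norm x)) \<partial>lborel)"
      by (rule nn_integral_cong_AE, use AE_lborel_singleton[of "0::'a"] in eventually_elim) (rule *)
    finally show "(\<integral>\<^sup>+x. h x * ?w x * ?k (ln (norm x) - s) \<partial>lborel) = (\<integral>\<^sup>+x. h (exp s *\<^sub>R x) * ?w x * ?k (ln (norm x)) \<partial>lborel)" .
  qed
  also have "\<dots> = (\<integral>\<^sup>+x. (\<integral>\<^sup>+s. h (exp s *\<^sub>R x) * ?w x * ?k (ln (norm x)) \<partial>lborel) \<partial>lborel)"
    by (rule lborel_pair.Fubini') measurable
  also have "\<dots> = (\<integral>\<^sup>+x. ?k (ln (norm x)) * ?w x * (\<integral>\<^sup>+s. h (exp s *\<^sub>R x) \<partial>lborel) \<partial>lborel)"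
    by (intro nn_integral_cong) (subst nn_integral_cmult[symmetric], measurable, simp add: mult_ac)
  finally show ?thesis .
qed

text \<open>In the logarithm of the radius the power map is affine with slope \<kappa> on each
  orbit, so it only multiplies the invariant measure by a constant. Negative \<kappa> is allowed on
  purpose: \<kappa> = -1 is the inversion, which handles integrals near infinity.\<close>

lemma nn_integral_radial_power:
  fixes h :: "'a::euclidean_space \<Rightarrow> ennreal"
  assumes [measurable]: "h \<in> borel_measurable borel" and k: "\<kappa> \<noteq> 0"
  shows "(\<integral>\<^sup>+x. h x * ennreal (norm x powr - real DIM('a)) \<partial>lborel) =
    ennreal \<bar>\<kappa>\<bar> * (\<integral>\<^sup>+y. h (norm y powr (\<kappa> - 1) *\<^sub>R y) * ennreal (norm y powr - real DIM('a)) \<partial>lborel)"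
proof -
  let ?w = "\<lambda>x::'a. ennreal (norm x powr - real DIM('a))"
  let ?k = "\<lambda>t::real. indicator {0..1} t :: ennreal"
  let ?P = "\<lambda>y::'a. norm y powr (\<kappa> - 1) *\<^sub>R y"
  have *: "ennreal \<bar>\<kappa>\<bar> * (\<integral>\<^sup>+s. h (?P (exp s *\<^sub>R x)) \<partial>lborel) = (\<integral>\<^sup>+s. h (exp s *\<^sub>R x) \<partial>lborel)" if "x \<noteq> 0" for x
  proof -
    let ?c = "(\<kappa> - 1) * ln (norm x)"
    have "?P (exp s *\<^sub>R x) = exp (\<kappa> *\<^sub>R s + ?c) *\<^sub>R x" for s
    proof -
      have "norm (exp s *\<^sub>R x) powr (\<kappa> - 1) = exp ((\<kappa> - 1) * (s + ln (norm x)))"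
        using that by (simp add: powr_def ln_mult)
      moreover have "exp ((\<kappa> - 1) * (s + ln (norm x))) * exp s = exp (\<kappa> *\<^sub>R s + ?c)"
        by (simp add: algebra_simps flip: exp_add)
      ultimately show ?thesis
        by (simp only: scaleR_scaleR)
    qed
    note P = this
    have "ennreal \<bar>\<kappa>\<bar> * (\<integral>\<^sup>+s. h (?P (exp s *\<^sub>R x)) \<partial>lborel) = (\<integral>\<^sup>+s. h (exp (s + ?c) *\<^sub>R x) \<partial>lborel)"
      using nn_integral_lborel_dilation[of "\<lambda>s. h (exp (s + ?c) *\<^sub>R x)" \<kappa>] k by (simp only: P) simp
    also have "\<dots> = (\<integral>\<^sup>+s. h (exp s *\<^sub>R x) \<partial>lborel)"
      by (rule nn_integral_lborel_translation) measurable
    finally show ?thesis .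
  qed
  have "ennreal \<bar>\<kappa>\<bar> * (\<integral>\<^sup>+y. h (?P y) * ?w y \<partial>lborel) =
     ennreal \<bar>\<kappa>\<bar> * (\<integral>\<^sup>+x. ?k (ln (norm x)) * ?w x * (\<integral>\<^sup>+s. h (?P (exp s *\<^sub>R x)) \<partial>lborel) \<partial>lborel)"
    by (subst nn_integral_dilation_average) auto
  also have "\<dots> = (\<integral>\<^sup>+x. ennreal \<bar>\<kappa>\<bar> * (?k (ln (norm x)) * ?w x * (\<integral>\<^sup>+s. h (?P (exp s *\<^sub>R x)) \<partial>lborel)) \<partial>lborel)"
    by (subst nn_integral_cmult) auto
  also have "\<dots> = (\<integral>\<^sup>+x. ?k (ln (norm x)) * ?w x * (\<integral>\<^sup>+s. h (exp s *\<^sub>R x) \<partial>lborel) \<partial>lborel)"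
    by (rule nn_integral_cong_AE, use AE_lborel_singleton[of "0::'a"] in eventually_elim)
       (simp add: *[symmetric] ac_simps)
  also have "\<dots> = (\<integral>\<^sup>+x. h x * ?w x \<partial>lborel)"
    by (rule nn_integral_dilation_average[symmetric]) auto
  finally show ?thesis by simp
qed

text \<open>Apply the invariant form to h times |x| powr (DIM / \<kappa>): the image of y has norm
  |y| powr \<kappa>, so the extra factor becomes |y| powr DIM and cancels the invariant
  density.\<close>

lemma nn_integral_radial_substitution:
  fixes h :: "'a::euclidean_space \<Rightarrow> ennreal"
  assumes [measurable]: "h \<in> borel_measurable borel" and k: "\<kappa> > 0"
  shows "(\<integral>\<^sup>+x. h x * ennreal (norm x powr (DIM('a) / \<kappa> - DIM('a))) \<partial>lborel) =
    ennreal \<kappa> * (\<integral>\<^sup>+y. h (norm y powr (\<kappa> - 1) *\<^sub>R y) \<partial>lborel)"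
proof -
  let ?N = "real DIM('a)"
  have "(\<integral>\<^sup>+x. h x * ennreal (norm x powr (?N / \<kappa> - ?N)) \<partial>lborel) =
        (\<integral>\<^sup>+x. (h x * ennreal (norm x powr (?N / \<kappa>))) * ennreal (norm x powr - ?N) \<partial>lborel)"
    by (intro nn_integral_cong) (simp add: mult.assoc powr_add[symmetric] flip: ennreal_mult)
  also have "\<dots> = ennreal \<kappa> * (\<integral>\<^sup>+y. (h (norm y powr (\<kappa> - 1) *\<^sub>R y) *
      ennreal (norm (norm y powr (\<kappa> - 1) *\<^sub>R y) powr (?N / \<kappa>))) * ennreal (norm y powr - ?N) \<partial>lborel)"
    using k by (subst nn_integral_radial_power[where \<kappa>=\<kappa>]) auto
  also have "(\<integral>\<^sup>+y. (h (norm y powr (\<kappa> - 1) *\<^sub>R y) *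
      ennreal (norm (norm y powr (\<kappa> - 1) *\<^sub>R y) powr (?N / \<kappa>))) * ennreal (norm y powr - ?N) \<partial>lborel)
    = (\<integral>\<^sup>+y. h (norm y powr (\<kappa> - 1) *\<^sub>R y) \<partial>lborel)"
  proof (rule nn_integral_cong_AE, use AE_lborel_singleton[of "0::'a"] in eventually_elim)
    fix y :: 'a assume y: "y \<noteq> 0"
    have "norm (norm y powr (\<kappa> - 1) *\<^sub>R y) = norm y powr (\<kappa> - 1) * norm y powr 1"
      using y by simp
    also have "\<dots> = norm y powr \<kappa>"
      by (simp only: powr_add[symmetric]) simp
    finally have "norm (norm y powr (\<kappa> - 1) *\<^sub>R y) powr (?N / \<kappa>) * norm y powr - ?N = 1"
      using y k by (simp only: powr_powr powr_add[symmetric]) simp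
    then have "ennreal (norm (norm y powr (\<kappa> - 1) *\<^sub>R y) powr (?N / \<kappa>)) * ennreal (norm y powr - ?N) = 1"
      by (simp flip: ennreal_mult)
    then show "(h (norm y powr (\<kappa> - 1) *\<^sub>R y) *
      ennreal (norm (norm y powr (\<kappa> - 1) *\<^sub>R y) powr (?N / \<kappa>))) * ennreal (norm y powr - ?N) = h (norm y powr (\<kappa> - 1) *\<^sub>R y)"
      by (simp only: mult.assoc mult_1_right)
  qed
  finally show ?thesis .
qed

section \<open>Integrability of powers of the norm and of Gaussian moments\<close>

lemma nn_integral_norm_powr_cball:
  fixes p R :: real
  assumes p: "p < DIM('a)"
  shows "(\<integral>\<^sup>+x. indicator (cball (0::'a::euclidean_space) R) x * ennreal (norm x powr - p) \<partial>lborel) < \<infinity>"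
proof -
  \<comment> \<open>The solution of DIM / \<kappa> - DIM = - p: the substitution makes the density
    constant, and the preimage of the ball lies in a ball.\<close>
  define \<kappa> where "\<kappa> = DIM('a) / (DIM('a) - p)"
  have k: "\<kappa> > 0" and e: "DIM('a) / \<kappa> - DIM('a) = - p"
    using p by (auto simp: \<kappa>_def)
  have "(\<integral>\<^sup>+x. indicator (cball (0::'a) R) x * ennreal (norm x powr - p) \<partial>lborel)
     = ennreal \<kappa> * (\<integral>\<^sup>+y. indicator (cball (0::'a) R) (norm y powr (\<kappa> - 1) *\<^sub>R y) \<partial>lborel)"
    using nn_integral_radial_substitution[OF borel_measurable_indicator k, of "cball (0::'a) R"]
    by (simp only: e) simp
  also have "\<dots> \<le> ennreal \<kappa> * (\<integral>\<^sup>+y. indicator (cball (0::'a) (R powr (1 / \<kappa>))) y \<partial>lborel)"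
  proof (intro mult_left_mono nn_integral_mono)
    fix y :: 'a
    have "norm y \<le> R powr (1 / \<kappa>)" if le: "norm y powr (\<kappa> - 1) * norm y \<le> R" and "y \<noteq> 0"
    proof -
      have "norm y powr \<kappa> = norm y powr (\<kappa> - 1) * norm y"
        using powr_add[of "norm y" "\<kappa> - 1" 1] \<open>y \<noteq> 0\<close> by simp
      with le have "norm y powr \<kappa> \<le> R" by simp
      then have "(norm y powr \<kappa>) powr (1 / \<kappa>) \<le> R powr (1 / \<kappa>)"
        using k by (intro powr_mono2) auto
      then show ?thesis using k by (simp add: powr_powr)
    qed
    then show "indicator (cball (0::'a) R) (norm y powr (\<kappa> - 1) *\<^sub>R y) \<le> (indicator (cball (0::'a) (R powr (1 / \<kappa>))) y :: ennreal)"
      by (cases "y = 0") (auto simp: indicator_def)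
  qed auto
  also have "\<dots> < \<infinity>"
    using emeasure_bounded_finite[of "cball (0::'a) (R powr (1 / \<kappa>))"]
    by (auto simp: ennreal_mult_less_top)
  finally show ?thesis .
qed

lemma nn_integral_norm_powr_outside_unit_ball:
  "(\<integral>\<^sup>+x. indicator {x::'a::euclidean_space. norm x \<ge> 1} x * ennreal (norm x powr - (2 * real DIM('a))) \<partial>lborel) < \<infinity>"
proof -
  let ?N = "real DIM('a)"
  let ?S = "{x::'a. norm x \<ge> 1}"
  have [measurable]: "?S \<in> sets borel"
    by measurable
  have "(\<integral>\<^sup>+x. indicator ?S x * ennreal (norm x powr - (2 * ?N)) \<partial>lborel)
      = (\<integral>\<^sup>+x. (indicator ?S x * ennreal (norm x powr - ?N)) * ennreal (norm x powr - ?N) \<partial>lborel)"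
    by (intro nn_integral_cong) (simp add: mult.assoc powr_add[symmetric] flip: ennreal_mult)
  also have "\<dots> = (\<integral>\<^sup>+y. (indicator ?S (norm y powr (-2) *\<^sub>R y) *
      ennreal (norm (norm y powr (-2) *\<^sub>R y) powr - ?N)) * ennreal (norm y powr - ?N) \<partial>lborel)"
    \<comment> \<open>Inversion carries the exterior region into the unit ball, and |x| powr (- 2
      DIM) is its Jacobian.\<close>
    by (subst nn_integral_radial_power[where \<kappa>="-1"]) auto
  also have "\<dots> \<le> (\<integral>\<^sup>+y. indicator (cball (0::'a) 1) y \<partial>lborel)"
  proof (rule nn_integral_mono_AE, use AE_lborel_singleton[of "0::'a"] in eventually_elim)
    fix y :: 'a assume y: "y \<noteq> 0"
    have n: "norm (norm y powr (-2) *\<^sub>R y) = norm y powr - 1"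
      using y powr_add[of "norm y" "-2" 1] by simp
    then have "norm (norm y powr (-2) *\<^sub>R y) powr - ?N * norm y powr - ?N = 1"
      using y by (simp only: powr_powr powr_add[symmetric]) simp
    then have "ennreal (norm (norm y powr (-2) *\<^sub>R y) powr - ?N) * ennreal (norm y powr - ?N) = 1"
      by (simp flip: ennreal_mult)
    moreover have "indicator ?S (norm y powr (-2) *\<^sub>R y) \<le> (indicator (cball (0::'a) 1) y :: ennreal)"
      using n y by (auto simp: indicator_def powr_minus_divide field_simps)
    ultimately show "(indicator ?S (norm y powr (-2) *\<^sub>R y) *
      ennreal (norm (norm y powr (-2) *\<^sub>R y) powr - ?N)) * ennreal (norm y powr - ?N) \<le> indicator (cball (0::'a) 1) y"
      by (simp only: mult.assoc mult_1_right)
  qed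
  also have "\<dots> < \<infinity>"
    using emeasure_bounded_finite[of "cball (0::'a) 1"] by simp
  finally show ?thesis .
qed

lemma nn_integral_gaussian_moment:
  assumes l: "c > 0"
  shows "(\<integral>\<^sup>+(x::'a::euclidean_space). ennreal ((1 + (norm x)\<^sup>2) * exp (- c * (norm x)\<^sup>2)) \<partial>lborel) < \<infinity>"
proof -
  \<comment> \<open>Bounding the exponential below by its term of degree n gives decay of order 2 -
    2 n = - 2 DIM once the quadratic factor is paid for, which is the power known to be integrable
    at infinity.\<close>
  define n where "n = Suc DIM('a)"
  define C where "C = 2 * fact n / c ^ n"
  let ?S = "{x::'a. norm x \<ge> 1}"
  have [measurable]: "?S \<in> sets borel"
    by measurable
  have [measurable]: "cball (0::'a) 1 \<in> sets borel"
    by (intro borel_closed closed_cball)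
  have C: "C \<ge> 0" using l by (simp add: C_def)
  have pw: "ennreal ((1 + (norm x)\<^sup>2) * exp (- c * (norm x)\<^sup>2)) \<le>
    ennreal 2 * indicator (cball 0 1) x + ennreal C * (indicator ?S x * ennreal (norm x powr - (2 * real DIM('a))))" for x :: 'a
  proof (cases "norm x \<le> 1")
    case True
    have "(1 + (norm x)\<^sup>2) * exp (- c * (norm x)\<^sup>2) \<le> 2 * 1"
      using True l by (intro mult_mono) (auto simp: power_le_one)
    then have "ennreal ((1 + (norm x)\<^sup>2) * exp (- c * (norm x)\<^sup>2)) \<le> ennreal 2 * indicator (cball 0 1) x"
      using True ennreal_leI[of _ 2] by simp
    then show ?thesis
      using order_trans by fastforce
  next
    case False
    define r where "r = norm x"
    have r: "r > 1" using False by (simp add: r_def)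
    have "(c * r\<^sup>2) ^ n / fact n \<le> exp (c * r\<^sup>2)"
    proof -
      have "(\<Sum>k\<in>{n}. (c * r\<^sup>2) ^ k /\<^sub>R fact k) \<le> (\<Sum>k. (c * r\<^sup>2) ^ k /\<^sub>R fact k)"
        using l summable_exp_generic[of "c * r\<^sup>2"] by (intro sum_le_suminf) auto
      then show ?thesis
        by (simp add: exp_def divide_inverse mult.commute)
    qed
    moreover have "(c * r\<^sup>2) ^ n > 0" using l r by simp
    ultimately have "exp (- c * r\<^sup>2) \<le> fact n / (c * r\<^sup>2) ^ n"
      by (simp add: exp_minus field_simps)
    moreover have "1 + r\<^sup>2 \<le> 2 * r\<^sup>2" using r by simp
    ultimately have "(1 + r\<^sup>2) * exp (- c * r\<^sup>2) \<le> (2 * r\<^sup>2) * (fact n / (c * r\<^sup>2) ^ n)"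
      by (intro mult_mono) auto
    also have "\<dots> = C * (r powr - (2 * real DIM('a)))"
    proof -
      have "r powr - (2 * real DIM('a)) = 1 / r ^ (2 * DIM('a))"
        using r powr_realpow[of r "2 * DIM('a)"] by (simp add: powr_minus_divide)
      moreover have "r\<^sup>2 * (1 / (r\<^sup>2) ^ n) = 1 / r ^ (2 * DIM('a))"
        using r by (simp add: n_def power_mult)
      moreover have "2 * r\<^sup>2 * (fact n / (c * r\<^sup>2) ^ n) = C * (r\<^sup>2 * (1 / (r\<^sup>2) ^ n))"
        by (simp add: C_def power_mult_distrib)
      ultimately show ?thesis
        by (simp only:)
    qed
    finally have "ennreal ((1 + r\<^sup>2) * exp (- c * r\<^sup>2)) \<le> ennreal C * ennreal (r powr - (2 * real DIM('a)))"
      using C by (simp flip: ennreal_mult)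
    then show ?thesis
      using r by (simp add: r_def)
  qed
  have "(\<integral>\<^sup>+(x::'a). ennreal ((1 + (norm x)\<^sup>2) * exp (- c * (norm x)\<^sup>2)) \<partial>lborel)
     \<le> (\<integral>\<^sup>+x. ennreal 2 * indicator (cball 0 1) x + ennreal C * (indicator ?S x * ennreal (norm x powr - (2 * real DIM('a)))) \<partial>lborel)"
    by (intro nn_integral_mono pw)
  also have "\<dots> = ennreal 2 * (\<integral>\<^sup>+x. indicator (cball (0::'a) 1) x \<partial>lborel) +
      ennreal C * (\<integral>\<^sup>+x. (indicator ?S x * ennreal (norm x powr - (2 * real DIM('a)))) \<partial>lborel)"
    by (subst nn_integral_add, measurable, measurable)
       (subst nn_integral_cmult, measurable, subst nn_integral_cmult, measurable)
  also have "\<dots> < \<infinity>"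
    using emeasure_bounded_finite[of "cball (0::'a) 1"] nn_integral_norm_powr_outside_unit_ball[where 'a='a]
    by (auto simp: ennreal_mult_less_top)
  finally show ?thesis .
qed

section \<open>Rotations in the product of two copies of the space\<close>

lemma nn_integral_lborel_shear:
  fixes F :: "'a::euclidean_space \<Rightarrow> 'a \<Rightarrow> ennreal"
  assumes F [measurable]: "(\<lambda>(x, y). F x y) \<in> borel_measurable (borel \<Otimes>\<^sub>M borel)"
  shows "(\<integral>\<^sup>+x. \<integral>\<^sup>+y. F (x + t *\<^sub>R y) y \<partial>lborel \<partial>lborel) = (\<integral>\<^sup>+x. \<integral>\<^sup>+y. F x y \<partial>lborel \<partial>lborel)"
    and "(\<integral>\<^sup>+x. \<integral>\<^sup>+y. F x (y + t *\<^sub>R x) \<partial>lborel \<partial>lborel) = (\<integral>\<^sup>+x. \<integral>\<^sup>+y. F x y \<partial>lborel \<partial>lborel)"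
proof -
  have "(\<integral>\<^sup>+x. \<integral>\<^sup>+y. F (x + t *\<^sub>R y) y \<partial>lborel \<partial>lborel) = (\<integral>\<^sup>+y. \<integral>\<^sup>+x. F (x + t *\<^sub>R y) y \<partial>lborel \<partial>lborel)"
    by (rule lborel_pair.Fubini') measurable
  also have "\<dots> = (\<integral>\<^sup>+y. \<integral>\<^sup>+x. F x y \<partial>lborel \<partial>lborel)"
    by (intro nn_integral_cong nn_integral_lborel_translation) measurable
  also have "\<dots> = (\<integral>\<^sup>+x. \<integral>\<^sup>+y. F x y \<partial>lborel \<partial>lborel)"
    by (rule lborel_pair.Fubini') measurable
  finally show "(\<integral>\<^sup>+x. \<integral>\<^sup>+y. F (x + t *\<^sub>R y) y \<partial>lborel \<partial>lborel) = (\<integral>\<^sup>+x. \<integral>\<^sup>+y. F x y \<partial>lborel \<partial>lborel)" .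
  show "(\<integral>\<^sup>+x. \<integral>\<^sup>+y. F x (y + t *\<^sub>R x) \<partial>lborel \<partial>lborel) = (\<integral>\<^sup>+x. \<integral>\<^sup>+y. F x y \<partial>lborel \<partial>lborel)"
    by (intro nn_integral_cong nn_integral_lborel_translation) measurable
qed

text \<open>A rotation by \<theta> is a product of three shears with parameters tan (\<theta> / 2),
  - sin \<theta>, tan (\<theta> / 2), and a shear is a translation in one variable with the other
  fixed. The half turn is excluded because tan (\<theta> / 2) is infinite there.\<close>

lemma nn_integral_lborel_pair_rotation:
  fixes F :: "'a::euclidean_space \<Rightarrow> 'a \<Rightarrow> ennreal"
  assumes F [measurable]: "(\<lambda>(x, y). F x y) \<in> borel_measurable (borel \<Otimes>\<^sub>M borel)"
    and cs: "c\<^sup>2 + s\<^sup>2 = 1" "c \<noteq> -1"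
  shows "(\<integral>\<^sup>+x. \<integral>\<^sup>+y. F (c *\<^sub>R x + s *\<^sub>R y) (- s *\<^sub>R x + c *\<^sub>R y) \<partial>lborel \<partial>lborel) =
    (\<integral>\<^sup>+x. \<integral>\<^sup>+y. F x y \<partial>lborel \<partial>lborel)"
proof -
  define t where "t = s / (1 + c)"
  have c0: "1 + c \<noteq> 0" using cs by auto
  have "t * s * (1 + c) = s\<^sup>2"
    using c0 by (simp add: t_def power2_eq_square)
  also have "\<dots> = (1 - c) * (1 + c)"
    using cs by (simp add: power2_eq_square algebra_simps)
  finally have "t * s * (1 + c) = (1 - c) * (1 + c)" .
  then have ts: "t * s = 1 - c" using c0 by simp
  have "t * (1 + c) = s" using c0 by (simp add: t_def)
  then have tc: "t * c = s - t" by (simp add: algebra_simps)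
  define F1 where "F1 = (\<lambda>x y. F (x + t *\<^sub>R y) y)"
  define F2 where "F2 = (\<lambda>x y. F1 x (y + (-s) *\<^sub>R x))"
  have [measurable]: "(\<lambda>(x, y). F1 x y) \<in> borel_measurable (borel \<Otimes>\<^sub>M borel)"
    unfolding F1_def by measurable
  have [measurable]: "(\<lambda>(x, y). F2 x y) \<in> borel_measurable (borel \<Otimes>\<^sub>M borel)"
    unfolding F2_def by measurable
  have "F2 (x + t *\<^sub>R y) y = F (c *\<^sub>R x + s *\<^sub>R y) (- s *\<^sub>R x + c *\<^sub>R y)" for x y
  proof -
    have 1: "y + (-s) *\<^sub>R (x + t *\<^sub>R y) = - s *\<^sub>R x + (1 - t * s) *\<^sub>R y"
      by (simp add: algebra_simps)
    have 2: "(x + t *\<^sub>R y) + t *\<^sub>R (- s *\<^sub>R x + c *\<^sub>R y) = (1 - t * s) *\<^sub>R x + (t + t * c) *\<^sub>R y"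
      by (simp add: algebra_simps)
    show ?thesis
      unfolding F2_def F1_def 1 using 2 by (simp add: ts tc)
  qed
  then have "(\<integral>\<^sup>+x. \<integral>\<^sup>+y. F (c *\<^sub>R x + s *\<^sub>R y) (- s *\<^sub>R x + c *\<^sub>R y) \<partial>lborel \<partial>lborel)
     = (\<integral>\<^sup>+x. \<integral>\<^sup>+y. F2 (x + t *\<^sub>R y) y \<partial>lborel \<partial>lborel)"
    by simp
  also have "\<dots> = (\<integral>\<^sup>+x. \<integral>\<^sup>+y. F2 x y \<partial>lborel \<partial>lborel)"
    by (rule nn_integral_lborel_shear) measurable
  also have "\<dots> = (\<integral>\<^sup>+x. \<integral>\<^sup>+y. F1 x y \<partial>lborel \<partial>lborel)"
    unfolding F2_def by (rule nn_integral_lborel_shear) measurable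
  also have "\<dots> = (\<integral>\<^sup>+x. \<integral>\<^sup>+y. F x y \<partial>lborel \<partial>lborel)"
    unfolding F1_def by (rule nn_integral_lborel_shear) measurable
  finally show ?thesis .
qed

section \<open>A Gaussian Poincare inequality\<close>

text \<open>The fundamental theorem of calculus delivers \<open>q\<close> only as gauge integrable.
  If the right-hand side is finite, \<open>q\<close> is square integrable on a bounded interval, so
  its gauge and Lebesgue integrals agree and Cauchy-Schwarz applies; otherwise nothing is to be
  shown.\<close>

lemma has_integral_square_le:
  fixes q :: "real \<Rightarrow> real"
  assumes q [measurable]: "q \<in> borel_measurable borel" and T: "T > 0"
    and I: "(q has_integral I) {0..T}"
  shows "ennreal (I\<^sup>2) \<le> ennreal T * (\<integral>\<^sup>+s. indicator {0..T} s * ennreal ((q s)\<^sup>2) \<partial>lborel)"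
proof (cases "(\<integral>\<^sup>+s. indicator {0..T} s * ennreal ((q s)\<^sup>2) \<partial>lborel) = \<infinity>")
  case True
  then show ?thesis using T by (simp add: ennreal_mult_eq_top_iff)
next
  case False
  let ?i = "indicator {0..T} :: real \<Rightarrow> real"
  have eq: "(\<integral>\<^sup>+s. indicator {0..T} s * ennreal ((q s)\<^sup>2) \<partial>lborel) = (\<integral>\<^sup>+s. ennreal (?i s * (q s)\<^sup>2) \<partial>lborel)"
    by (intro nn_integral_cong) (simp add: indicator_def)
  have q2: "integrable lborel (\<lambda>s. ?i s * (q s)\<^sup>2)"
    using False eq by (intro integrableI_nonneg) (auto simp: less_top)
  have i1: "integrable lborel ?i"
    using T by (intro integrable_real_indicator) auto
  have q1: "integrable lborel (\<lambda>s. ?i s * q s)"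
  proof (rule Bochner_Integration.integrable_bound)
    show "integrable lborel (\<lambda>s. ?i s + ?i s * (q s)\<^sup>2)"
      using i1 q2 by simp
    have "\<bar>z\<bar> \<le> 1 + z\<^sup>2" for z :: real
    proof -
      have "0 \<le> (\<bar>z\<bar> - 1)\<^sup>2" by simp
      then have "2 * \<bar>z\<bar> \<le> 1 + z\<^sup>2" by (simp add: power2_eq_square algebra_simps)
      then show ?thesis using abs_ge_zero[of z] by linarith
    qed
    then show "AE s in lborel. norm (?i s * q s) \<le> norm (?i s + ?i s * (q s)\<^sup>2)"
      by (intro AE_I2) (simp add: indicator_def)
  qed simp
  have "set_integrable lborel {0..T} q"
    using q1 by (simp add: set_integrable_def)
  from set_borel_integral_eq_integral[OF this] I
  have Iq: "(\<integral>s. ?i s * q s \<partial>lborel) = I"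
    by (simp add: set_lebesgue_integral_def integral_unique)
  define Q where "Q = (\<integral>s. ?i s * (q s)\<^sup>2 \<partial>lborel)"
  \<comment> \<open>Cauchy-Schwarz as nonnegativity of the squared deviation from the mean
    \<open>I / T\<close>.\<close>
  have "0 \<le> (\<integral>s. ?i s * (q s - I / T)\<^sup>2 \<partial>lborel)"
    by (intro integral_nonneg_AE AE_I2) simp
  also have "\<dots> = (\<integral>s. ?i s * (q s)\<^sup>2 - 2 * (I / T) * (?i s * q s) + (I / T)\<^sup>2 * ?i s \<partial>lborel)"
    by (intro Bochner_Integration.integral_cong) (auto simp: power2_eq_square algebra_simps)
  also have "\<dots> = Q - 2 * (I / T) * I + (I / T)\<^sup>2 * T"
    using q1 q2 i1 T Iq by (simp add: Q_def)
  also have "\<dots> = Q - I\<^sup>2 / T"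
    using T by (simp add: power2_eq_square field_simps)
  finally have "I\<^sup>2 \<le> T * Q"
    using T by (simp add: field_simps)
  moreover have "Q \<ge> 0"
    unfolding Q_def by (intro integral_nonneg_AE AE_I2) simp
  moreover have "(\<integral>\<^sup>+s. ennreal (?i s * (q s)\<^sup>2) \<partial>lborel) = ennreal Q"
    unfolding Q_def by (intro nn_integral_eq_integral q2 AE_I2) simp
  ultimately show ?thesis
    using T eq by (simp add: ennreal_leI flip: ennreal_mult)
qed

text \<open>The fundamental theorem of calculus along the arc from \<open>x\<close> to
  \<open>y\<close>, then Cauchy-Schwarz on an interval of length pi / 2. The arc may cross the
  origin, where no derivative is assumed; it does so at most once in the open interval, and
  continuity of \<open>f\<close> bridges a finite exceptional set.\<close>

lemma quarter_rotation_increment_le: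
  fixes f :: "'a::euclidean_space \<Rightarrow> real" and G :: "'a \<Rightarrow> 'a"
  assumes f: "continuous_on UNIV f" and G [measurable]: "G \<in> borel_measurable borel"
    and d: "\<And>y. y \<noteq> 0 \<Longrightarrow> (f has_derivative (\<lambda>h. G y \<bullet> h)) (at y)"
  shows "ennreal ((f x - f y)\<^sup>2) \<le> ennreal (pi / 2) * (\<integral>\<^sup>+s. indicator {0..pi/2} s *
     ennreal ((norm (G (cos s *\<^sub>R x + sin s *\<^sub>R y)))\<^sup>2 * (norm (- sin s *\<^sub>R x + cos s *\<^sub>R y))\<^sup>2) \<partial>lborel)"
proof (cases "x = 0 \<and> y = 0")
  case True
  then show ?thesis by simp
next
  case False
  define z where "z s = cos s *\<^sub>R x + sin s *\<^sub>R y" for s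
  define z' where "z' s = - sin s *\<^sub>R x + cos s *\<^sub>R y" for s
  define S where "S = {s \<in> {0<..<pi/2}. z s = 0}"
  \<comment> \<open>Zeros of the arc at two different times would force sin (s - t) times
    \<open>x\<close> and times \<open>y\<close> to vanish, hence x = y = 0.\<close>
  have "s = t" if s: "s \<in> S" and t: "t \<in> S" for s t
  proof (rule ccontr)
    assume "s \<noteq> t"
    have st: "z s = 0" "z t = 0" "s \<in> {0<..<pi/2}" "t \<in> {0<..<pi/2}" using s t by (auto simp: S_def)
    have sn: "sin (s - t) \<noteq> 0"
      using \<open>s \<noteq> t\<close> st(3,4) sin_gt_zero[of "s - t"] sin_gt_zero[of "t - s"] sin_minus[of "s - t"]
      by (cases "s < t") auto
    have "sin (s - t) *\<^sub>R x = sin s *\<^sub>R z t - sin t *\<^sub>R z s"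
      by (simp add: z_def sin_diff algebra_simps)
    moreover have "sin (s - t) *\<^sub>R y = cos t *\<^sub>R z s - cos s *\<^sub>R z t"
      by (simp add: z_def sin_diff algebra_simps)
    ultimately show False using st sn False by simp
  qed
  then have "S \<subseteq> {SOME s. s \<in> S}"
    by (metis singletonI someI_ex subsetI)
  then have fin: "finite S"
    using finite_subset by blast
  define q where "q s = G (z s) \<bullet> z' s" for s
  have vz: "(z has_vector_derivative z' s) (at s)" for s
    unfolding z_def z'_def by (auto intro!: derivative_eq_intros simp: algebra_simps)
  have deriv: "((f \<circ> z) has_vector_derivative q s) (at s)" if "s \<in> {0<..<pi/2} - S" for s
  proof -
    have "z s \<noteq> 0" using that by (auto simp: S_def)
    from diff_chain_at[OF vz[of s, unfolded has_vector_derivative_def] d[OF this]]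
    show ?thesis
      by (simp add: has_vector_derivative_def q_def o_def)
  qed
  have cont: "continuous_on {0..pi/2} (f \<circ> z)"
    unfolding z_def by (intro continuous_on_compose continuous_intros continuous_on_subset[OF f]) auto
  have "(q has_integral ((f \<circ> z) (pi/2) - (f \<circ> z) 0)) {0..pi/2}"
    by (rule fundamental_theorem_of_calculus_interior_strong[OF fin _ deriv cont]) auto
  then have I: "(q has_integral (f y - f x)) {0..pi/2}"
    by (simp add: z_def)
  have [measurable]: "z \<in> borel_measurable borel" "z' \<in> borel_measurable borel"
    unfolding z_def z'_def by measurable
  have "q \<in> borel_measurable borel"
    unfolding q_def by measurable
  from has_integral_square_le[OF this _ I]
  have "ennreal ((f x - f y)\<^sup>2) \<le> ennreal (pi / 2) * (\<integral>\<^sup>+s. indicator {0..pi/2} s * ennreal ((q s)\<^sup>2) \<partial>lborel)"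
    by (simp add: power2_commute)
  also have "\<dots> \<le> ennreal (pi / 2) * (\<integral>\<^sup>+s. indicator {0..pi/2} s * ennreal ((norm (G (z s)))\<^sup>2 * (norm (z' s))\<^sup>2) \<partial>lborel)"
  proof (intro mult_left_mono nn_integral_mono ennreal_leI)
    fix s
    have "\<bar>q s\<bar> \<le> norm (G (z s)) * norm (z' s)"
      unfolding q_def by (rule Cauchy_Schwarz_ineq2)
    then show "(q s)\<^sup>2 \<le> (norm (G (z s)))\<^sup>2 * (norm (z' s))\<^sup>2"
      using abs_le_square_iff[of "q s" "norm (G (z s)) * norm (z' s)"] by (simp add: power_mult_distrib)
  qed auto
  finally show ?thesis
    unfolding z_def z'_def .
qed

text \<open>The Maurey--Pisier argument: along the rotation by angle \<open>s\<close> the position and the velocity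
  are again independent Gaussians, so integrating the squared increment over all pairs decouples.\<close>

lemma gaussian_poincare:
  fixes f :: "'a::euclidean_space \<Rightarrow> real" and G :: "'a \<Rightarrow> 'a"
  assumes f: "continuous_on UNIV f" and G [measurable]: "G \<in> borel_measurable borel"
    and d: "\<And>y. y \<noteq> 0 \<Longrightarrow> (f has_derivative (\<lambda>h. G y \<bullet> h)) (at y)"
  shows "(\<integral>\<^sup>+x. \<integral>\<^sup>+y. ennreal ((f x - f y)\<^sup>2 * exp (- c * ((norm x)\<^sup>2 + (norm y)\<^sup>2))) \<partial>lborel \<partial>lborel)
    \<le> ennreal (pi\<^sup>2 / 4) * (\<integral>\<^sup>+(y::'a). ennreal ((norm y)\<^sup>2 * exp (- c * (norm y)\<^sup>2)) \<partial>lborel)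
       * (\<integral>\<^sup>+x. ennreal ((norm (G x))\<^sup>2 * exp (- c * (norm x)\<^sup>2)) \<partial>lborel)" (is "?L \<le> _ * ?M * ?E")
proof -
  have [measurable]: "f \<in> borel_measurable borel"
    using f by (rule borel_measurable_continuous_onI)
  define F where "F x y = ennreal ((norm (G x))\<^sup>2 * (norm y)\<^sup>2 * exp (- c * ((norm x)\<^sup>2 + (norm y)\<^sup>2)))" for x y :: 'a
  have [measurable]: "(\<lambda>(x, y). F x y) \<in> borel_measurable (borel \<Otimes>\<^sub>M borel)"
    unfolding F_def by measurable
  let ?R = "\<lambda>s x y. F (cos s *\<^sub>R x + sin s *\<^sub>R y) (- sin s *\<^sub>R x + cos s *\<^sub>R y)"
  have nrm: "(norm (cos s *\<^sub>R x + sin s *\<^sub>R y))\<^sup>2 + (norm (- sin s *\<^sub>R x + cos s *\<^sub>R y))\<^sup>2 = (norm x)\<^sup>2 + (norm y)\<^sup>2"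
    for s and x y :: 'a
  proof -
    have "(norm (a *\<^sub>R x + b *\<^sub>R y))\<^sup>2 + (norm (- b *\<^sub>R x + a *\<^sub>R y))\<^sup>2
        = (a\<^sup>2 + b\<^sup>2) * (norm x)\<^sup>2 + (a\<^sup>2 + b\<^sup>2) * (norm y)\<^sup>2" for a b
      unfolding power2_norm_eq_inner
      by (simp add: inner_commute power2_eq_square algebra_simps)
    from this[of "cos s" "sin s"] show ?thesis by simp
  qed
  have pw: "ennreal ((f x - f y)\<^sup>2 * exp (- c * ((norm x)\<^sup>2 + (norm y)\<^sup>2)))
     \<le> ennreal (pi / 2) * (\<integral>\<^sup>+s. indicator {0..pi/2} s * ?R s x y \<partial>lborel)" for x y
  proof -
    let ?e = "ennreal (exp (- c * ((norm x)\<^sup>2 + (norm y)\<^sup>2)))"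
    have "ennreal ((f x - f y)\<^sup>2 * exp (- c * ((norm x)\<^sup>2 + (norm y)\<^sup>2))) = ennreal ((f x - f y)\<^sup>2) * ?e"
      by (simp flip: ennreal_mult)
    also have "\<dots> \<le> ennreal (pi / 2) * (\<integral>\<^sup>+s. indicator {0..pi/2} s *
     ennreal ((norm (G (cos s *\<^sub>R x + sin s *\<^sub>R y)))\<^sup>2 * (norm (- sin s *\<^sub>R x + cos s *\<^sub>R y))\<^sup>2) \<partial>lborel) * ?e"
      by (intro mult_right_mono quarter_rotation_increment_le f G d) auto
    also have "\<dots> = ennreal (pi / 2) * (\<integral>\<^sup>+s. indicator {0..pi/2} s *
     ennreal ((norm (G (cos s *\<^sub>R x + sin s *\<^sub>R y)))\<^sup>2 * (norm (- sin s *\<^sub>R x + cos s *\<^sub>R y))\<^sup>2) * ?e \<partial>lborel)"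
      by (subst nn_integral_multc) (auto simp: mult.assoc)
    also have "\<dots> = ennreal (pi / 2) * (\<integral>\<^sup>+s. indicator {0..pi/2} s * ?R s x y \<partial>lborel)"
      unfolding F_def nrm by (simp add: mult.assoc flip: ennreal_mult)
    finally show ?thesis .
  qed
  have "?L \<le> (\<integral>\<^sup>+x. \<integral>\<^sup>+y. ennreal (pi / 2) * (\<integral>\<^sup>+s. indicator {0..pi/2} s * ?R s x y \<partial>lborel) \<partial>lborel \<partial>lborel)"
    by (intro nn_integral_mono pw)
  also have "\<dots> = ennreal (pi / 2) * (\<integral>\<^sup>+x. \<integral>\<^sup>+y. \<integral>\<^sup>+s. indicator {0..pi/2} s * ?R s x y \<partial>lborel \<partial>lborel \<partial>lborel)"
    by (simp add: nn_integral_cmult)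
  \<comment> \<open>The angle is moved outermost so that for each fixed angle rotation invariance
    removes the rotation altogether.\<close>
  also have "(\<integral>\<^sup>+x. \<integral>\<^sup>+y. \<integral>\<^sup>+s. indicator {0..pi/2} s * ?R s x y \<partial>lborel \<partial>lborel \<partial>lborel)
      = (\<integral>\<^sup>+x. \<integral>\<^sup>+s. \<integral>\<^sup>+y. indicator {0..pi/2} s * ?R s x y \<partial>lborel \<partial>lborel \<partial>lborel)"
    by (intro nn_integral_cong lborel_pair.Fubini') measurable
  also have "\<dots> = (\<integral>\<^sup>+s. \<integral>\<^sup>+x. \<integral>\<^sup>+y. indicator {0..pi/2} s * ?R s x y \<partial>lborel \<partial>lborel \<partial>lborel)"
    by (intro lborel_pair.Fubini') measurable
  also have "\<dots> = (\<integral>\<^sup>+s. indicator {0..pi/2} s * (\<integral>\<^sup>+x. \<integral>\<^sup>+y. ?R s x y \<partial>lborel \<partial>lborel) \<partial>lborel)"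
    by (simp add: nn_integral_cmult)
  also have "\<dots> = (\<integral>\<^sup>+s. indicator {0..pi/2} s * (\<integral>\<^sup>+x. \<integral>\<^sup>+y. F x y \<partial>lborel \<partial>lborel) \<partial>lborel)"
  proof (intro nn_integral_cong)
    fix s :: real
    show "indicator {0..pi/2} s * (\<integral>\<^sup>+x. \<integral>\<^sup>+y. ?R s x y \<partial>lborel \<partial>lborel) =
          indicator {0..pi/2} s * (\<integral>\<^sup>+x. \<integral>\<^sup>+y. F x y \<partial>lborel \<partial>lborel)"
    proof (cases "s \<in> {0..pi/2}")
      case True
      \<comment> \<open>On the quarter circle the cosine is nonnegative, so the excluded half turn
        never occurs.\<close>
      then have "cos s \<noteq> -1"
        using cos_ge_zero[of s] by auto
      then show ?thesis
        by (subst nn_integral_lborel_pair_rotation) auto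
    qed simp
  qed
  also have "\<dots> = ennreal (pi / 2) * (\<integral>\<^sup>+x. \<integral>\<^sup>+y. F x y \<partial>lborel \<partial>lborel)"
    by (simp add: nn_integral_multc)
  also have "(\<integral>\<^sup>+x. \<integral>\<^sup>+y. F x y \<partial>lborel \<partial>lborel) =
      (\<integral>\<^sup>+x. ennreal ((norm (G x))\<^sup>2 * exp (- c * (norm x)\<^sup>2)) * ?M \<partial>lborel)"
  proof (intro nn_integral_cong)
    fix x :: 'a
    have "F x y = ennreal ((norm (G x))\<^sup>2 * exp (- c * (norm x)\<^sup>2)) * ennreal ((norm y)\<^sup>2 * exp (- c * (norm y)\<^sup>2))" for y
      by (simp add: F_def exp_add[symmetric] algebra_simps flip: ennreal_mult exp_minus)
    then show "(\<integral>\<^sup>+y. F x y \<partial>lborel) = ennreal ((norm (G x))\<^sup>2 * exp (- c * (norm x)\<^sup>2)) * ?M"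
      by (simp add: nn_integral_cmult)
  qed
  also have "\<dots> = ?E * ?M"
    by (simp add: nn_integral_multc)
  \<comment> \<open>One factor pi / 2 comes from Cauchy-Schwarz along the arc, the other is the
    length of the angle interval, every angle contributing the same amount.\<close>
  also have "ennreal (pi / 2) * (ennreal (pi / 2) * (?E * ?M)) = ennreal (pi\<^sup>2 / 4) * ?M * ?E"
  proof -
    have "ennreal (pi / 2) * ennreal (pi / 2) = ennreal (pi\<^sup>2 / 4)"
      by (simp add: power2_eq_square flip: ennreal_mult)
    moreover have "ennreal (pi / 2) * (ennreal (pi / 2) * (A * B)) = (ennreal (pi / 2) * ennreal (pi / 2)) * B * A" for A B
      by (simp only: ac_simps)
    ultimately show ?thesis
      by (simp only:)
  qed
  finally show ?thesis .
qed

section \<open>The dilation identity\<close>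

lemma integral_lborel_dilation:
  fixes f :: "'a::euclidean_space \<Rightarrow> real"
  assumes [measurable]: "f \<in> borel_measurable borel" and t: "t > 0"
  shows "(\<integral>x. f (t *\<^sub>R x) \<partial>lborel) = (\<integral>x. f x \<partial>lborel) / t ^ DIM('a)"
proof -
  have "(\<integral>x. f x \<partial>lborel) = (\<integral>x. f x \<partial>density (distr lborel borel (\<lambda>x. 0 + t *\<^sub>R x)) (\<lambda>_. \<bar>t\<bar> ^ DIM('a)))"
    using lborel_affine[of t "0::'a"] t by simp
  also have "\<dots> = t ^ DIM('a) * (\<integral>x. f (t *\<^sub>R x) \<partial>lborel)"
    using t by (subst integral_density) (auto simp: integral_distr)
  finally show ?thesis
    using t by simp
qed

lemma continuous_compact_support_bounded:
  fixes f :: "'a::euclidean_space \<Rightarrow> 'b::real_normed_vector"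
  assumes "continuous_on UNIV f" and "\<And>x. norm x > R \<Longrightarrow> f x = 0"
  obtains M where "M > 0" "\<And>x. norm (f x) \<le> M"
proof -
  have "compact (f ` cball 0 R)"
    using assms(1) by (intro compact_continuous_image) (auto intro: continuous_on_subset)
  then obtain M where M: "M > 0" "\<And>x. x \<in> cball 0 R \<Longrightarrow> norm (f x) \<le> M"
    using compact_imp_bounded bounded_pos by (metis imageI)
  have "norm (f x) \<le> M" for x
    using M assms(2)[of x] by (cases "norm x > R") auto
  with M(1) that show thesis by blast
qed

lemma integrable_norm_powr_cball:
  fixes p R :: real
  assumes p: "p < DIM('a)"
  shows "integrable lborel (\<lambda>x. indicator (cball (0::'a::euclidean_space) R) x * norm x powr - p)"
proof (rule integrableI_nonneg)
  have [measurable]: "cball (0::'a) R \<in> sets borel"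
    by (intro borel_closed closed_cball)
  show "(\<lambda>x. indicator (cball (0::'a) R) x * norm x powr - p) \<in> borel_measurable lborel"
    by measurable
  have "(\<integral>\<^sup>+x. ennreal (indicator (cball (0::'a) R) x * norm x powr - p) \<partial>lborel)
    = (\<integral>\<^sup>+x. indicator (cball (0::'a) R) x * ennreal (norm x powr - p) \<partial>lborel)"
    by (intro nn_integral_cong) (simp add: indicator_def)
  then show "(\<integral>\<^sup>+x. ennreal (indicator (cball (0::'a) R) x * norm x powr - p) \<partial>lborel) < \<infinity>"
    using nn_integral_norm_powr_cball[OF p, of R] by simp
qed (simp add: indicator_def)

lemma integrable_norm_powr_weight:
  fixes f :: "'a::euclidean_space \<Rightarrow> real" and p :: real
  assumes f: "continuous_on UNIV f" and R: "\<And>x. norm x > R \<Longrightarrow> f x = 0" and p: "p < DIM('a)"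
  shows "integrable lborel (\<lambda>x. f x * norm x powr - p)"
proof -
  obtain M where M: "M > 0" "\<And>x. norm (f x) \<le> M"
    using continuous_compact_support_bounded[OF f R] by blast
  have [measurable]: "f \<in> borel_measurable borel"
    using f by (rule borel_measurable_continuous_onI)
  have [measurable]: "cball (0::'a) R \<in> sets borel"
    by (intro borel_closed closed_cball)
  show ?thesis
  proof (rule Bochner_Integration.integrable_bound)
    show "integrable lborel (\<lambda>x. M * (indicator (cball (0::'a) R) x * norm x powr - p))"
      using integrable_norm_powr_cball[OF p, of R] by simp
    show "AE x in lborel. norm (f x * norm x powr - p) \<le> norm (M * (indicator (cball (0::'a) R) x * norm x powr - p))"
    proof (intro AE_I2)
      fix x :: 'a
      show "norm (f x * norm x powr - p) \<le> norm (M * (indicator (cball (0::'a) R) x * norm x powr - p))"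
        using M R[of x] by (cases "norm x > R") (auto simp: abs_mult intro!: mult_right_mono)
    qed
  qed simp
qed

lemma gradient_outside_support:
  fixes \<psi> :: "'a::euclidean_space \<Rightarrow> real"
  assumes d: "\<And>x. (\<psi> has_derivative (\<lambda>h. D x \<bullet> h)) (at x)"
    and R: "\<And>x. norm x > R \<Longrightarrow> \<psi> x = 0" and x: "norm x > R"
  shows "D x = 0"
proof -
  have "open {y::'a. norm y > R}"
    by (intro open_Collect_less continuous_intros)
  then have "(\<psi> has_derivative (\<lambda>h. 0)) (at x)"
    by (rule has_derivative_transform_within_open[OF has_derivative_const]) (use x R in auto)
  from has_derivative_unique[OF d[of x] this] have "D x \<bullet> D x = 0"
    by (rule fun_cong)
  then show ?thesis by simp
qed

text \<open>Differentiate \<open>t \<mapsto> \<integral> \<psi> (t x) |x| powr (- p) dx = t powr (p - DIM) * \<integral> \<psi> x |x| powr (- p) dx\<close> at \<open>t = 1\<close>.\<close>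

lemma integral_radial_derivative:
  fixes \<psi> :: "'a::euclidean_space \<Rightarrow> real" and p :: real
  assumes d: "\<And>x. (\<psi> has_derivative (\<lambda>h. D x \<bullet> h)) (at x)" and D: "continuous_on UNIV D"
    and R: "\<And>x. norm x > R \<Longrightarrow> \<psi> x = 0" and p: "p < DIM('a)"
  shows "(\<integral>x. (D x \<bullet> x) * norm x powr - p \<partial>lborel) = - (DIM('a) - p) * (\<integral>x. \<psi> x * norm x powr - p \<partial>lborel)"
proof -
  define I where "I = (\<integral>x. \<psi> x * norm x powr - p \<partial>lborel)"
  have c: "continuous_on UNIV \<psi>"
    using d by (meson continuous_at_imp_continuous_on has_derivative_continuous)
  have [measurable]: "\<psi> \<in> borel_measurable borel" "D \<in> borel_measurable borel"
    using c D by (auto intro: borel_measurable_continuous_onI)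
  have D0: "norm x > R \<Longrightarrow> D x = 0" for x
    using gradient_outside_support[OF d R] by blast
  obtain M where M: "M > 0" "\<And>x. norm (D x) \<le> M"
    using continuous_compact_support_bounded[OF D D0] by blast
  \<comment> \<open>The global Lipschitz bound is what dominates the difference quotients
    below.\<close>
  have lip: "\<bar>\<psi> x - \<psi> y\<bar> \<le> M * norm (x - y)" for x y
  proof -
    have "onorm (\<lambda>h. D z \<bullet> h) \<le> M" for z
      using M(2)[of z] by (intro onorm_le) (metis Cauchy_Schwarz_ineq2 mult_right_mono norm_ge_zero order_trans real_norm_def)
    then show ?thesis
      using differentiable_bound[of UNIV \<psi> "\<lambda>x h. D x \<bullet> h" M x y] d by auto
  qed
  \<comment> \<open>The limit t \<rightarrow> 1 is taken along a sequence above 1, so that the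
    dilated functions still vanish outside the ball of radius \<open>R\<close>.\<close>
  define t where "t n = 1 + 1 / (real n + 1)" for n
  have t1: "t n > 1" for n by (simp add: t_def)
  have "t \<longlonglongrightarrow> 1"
  proof -
    have "t \<longlonglongrightarrow> 1 + 0"
      unfolding t_def using LIMSEQ_inverse_real_of_nat
      by (intro tendsto_add tendsto_const) (simp add: inverse_eq_divide add.commute)
    then show ?thesis by simp
  qed
  then have tlim: "filterlim t (at 1) sequentially"
    using t1 by (auto simp: filterlim_at less_imp_neq[THEN not_sym] intro!: always_eventually)
  define q where "q n x = (\<psi> (t n *\<^sub>R x) - \<psi> x) / (t n - 1) * norm x powr - p" for n x
  have int: "integrable lborel (\<lambda>x. \<psi> x * norm x powr - p)"
    by (rule integrable_norm_powr_weight[OF c R p])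
  have intt: "integrable lborel (\<lambda>x. \<psi> (t n *\<^sub>R x) * norm x powr - p)" for n
  proof (rule integrable_norm_powr_weight[OF _ _ p])
    show "continuous_on UNIV (\<lambda>x. \<psi> (t n *\<^sub>R x))"
      by (intro continuous_on_compose2[OF c] continuous_intros) auto
    show "\<psi> (t n *\<^sub>R x) = 0" if "norm x > R" for x
    proof (rule R)
      have "1 * norm x \<le> t n * norm x" using t1[of n] by (intro mult_right_mono) auto
      then show "norm (t n *\<^sub>R x) > R" using that t1[of n] by simp
    qed
  qed
  have dil: "(\<integral>x. \<psi> (t n *\<^sub>R x) * norm x powr - p \<partial>lborel) = t n powr (p - DIM('a)) * I" for n
  proof -
    have "(\<integral>x. \<psi> (t n *\<^sub>R x) * norm x powr - p \<partial>lborel) = (\<integral>x. t n powr p * (\<psi> (t n *\<^sub>R x) * norm (t n *\<^sub>R x) powr - p) \<partial>lborel)"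
      using t1[of n] by (intro Bochner_Integration.integral_cong) (auto simp: powr_mult powr_minus field_simps)
    also have "\<dots> = t n powr p * (I / t n ^ DIM('a))"
      using integral_lborel_dilation[of "\<lambda>x. \<psi> x * norm x powr - p" "t n"] t1[of n]
      by (simp add: I_def)
    also have "\<dots> = t n powr (p - DIM('a)) * I"
      using t1[of n] by (simp add: powr_diff powr_realpow)
    finally show ?thesis .
  qed
  have Iq: "(\<integral>x. q n x \<partial>lborel) = (t n powr (p - DIM('a)) - 1 powr (p - DIM('a))) / (t n - 1) * I" for n
  proof -
    have "(\<integral>x. q n x \<partial>lborel) = (\<integral>x. (\<psi> (t n *\<^sub>R x) * norm x powr - p - \<psi> x * norm x powr - p) / (t n - 1) \<partial>lborel)"
      unfolding q_def by (intro Bochner_Integration.integral_cong) (auto simp: algebra_simps)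
    also have "\<dots> = (t n powr (p - DIM('a)) * I - I) / (t n - 1)"
      using int intt by (simp add: dil I_def)
    finally show ?thesis by (simp add: algebra_simps diff_divide_distrib)
  qed
  have "((\<lambda>s::real. s powr (p - DIM('a))) has_real_derivative (p - DIM('a))) (at 1)"
    by (auto intro!: derivative_eq_intros)
  then have "((\<lambda>s. (s powr (p - DIM('a)) - 1 powr (p - DIM('a))) / (s - 1)) \<longlongrightarrow> (p - DIM('a))) (at 1)"
    by (simp add: has_field_derivative_iff)
  from filterlim_compose[OF this tlim]
  have lim1: "(\<lambda>n. \<integral>x. q n x \<partial>lborel) \<longlonglongrightarrow> (p - DIM('a)) * I"
    unfolding Iq by (intro tendsto_mult tendsto_const)
  have qlim: "(\<lambda>n. q n x) \<longlonglongrightarrow> (D x \<bullet> x) * norm x powr - p" for x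
  proof -
    have "((\<lambda>s. \<psi> (s *\<^sub>R x)) has_derivative (\<lambda>h. D (1 *\<^sub>R x) \<bullet> (h *\<^sub>R x))) (at 1)"
      by (rule has_derivative_compose[OF _ d]) (auto intro!: derivative_eq_intros)
    then have "((\<lambda>s. \<psi> (s *\<^sub>R x)) has_real_derivative (D x \<bullet> x)) (at 1)"
      by (simp add: has_field_derivative_def mult_commute_abs)
    then have "((\<lambda>s. (\<psi> (s *\<^sub>R x) - \<psi> x) / (s - 1)) \<longlongrightarrow> D x \<bullet> x) (at 1)"
      by (simp add: has_field_derivative_iff)
    from filterlim_compose[OF this tlim] show ?thesis
      unfolding q_def by (intro tendsto_mult tendsto_const)
  qed
  have "(\<lambda>n. \<integral>x. q n x \<partial>lborel) \<longlonglongrightarrow> (\<integral>x. (D x \<bullet> x) * norm x powr - p \<partial>lborel)"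
  \<comment> \<open>Inside the ball the quotient is at most \<open>M\<close> times |x|, hence at
    most \<open>M * R\<close>; outside it is 0. The remaining power of the norm is integrable on the
    ball because p < DIM.\<close>
  proof (rule integral_dominated_convergence[where w="\<lambda>x. M * (indicator (cball 0 R) x * R) * norm x powr - p"])
    have [measurable]: "cball (0::'a) R \<in> sets borel"
      by (intro borel_closed closed_cball)
    show "(\<lambda>x. (D x \<bullet> x) * norm x powr - p) \<in> borel_measurable lborel" "\<And>n. q n \<in> borel_measurable lborel"
      unfolding q_def by measurable
    have "integrable lborel (\<lambda>x. M * R * (indicator (cball (0::'a) R) x * norm x powr - p))"
      using integrable_norm_powr_cball[OF p, of R] by simp
    then show "integrable lborel (\<lambda>x. M * (indicator (cball (0::'a) R) x * R) * norm x powr - p)"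
      by (simp add: ac_simps)
    show "AE x in lborel. (\<lambda>n. q n x) \<longlonglongrightarrow> (D x \<bullet> x) * norm x powr - p"
      using qlim by simp
    show "AE x in lborel. norm (q n x) \<le> M * (indicator (cball 0 R) x * R) * norm x powr - p" for n
    proof (intro AE_I2)
      fix x :: 'a
      have "\<bar>\<psi> (t n *\<^sub>R x) - \<psi> x\<bar> / (t n - 1) \<le> M * (indicator (cball 0 R) x * R)"
      proof (cases "norm x > R")
        case True
        have "1 * norm x \<le> t n * norm x" using t1[of n] by (intro mult_right_mono) auto
        then have "norm (t n *\<^sub>R x) > R" using True t1[of n] by simp
        then show ?thesis using R True by simp
      next
        case False
        have "norm (t n *\<^sub>R x - x) = (t n - 1) * norm x"
          using t1[of n] norm_scaleR[of "t n - 1" x] by (simp add: scaleR_left_diff_distrib)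
        then have "\<bar>\<psi> (t n *\<^sub>R x) - \<psi> x\<bar> \<le> M * ((t n - 1) * norm x)"
          using lip[of "t n *\<^sub>R x" x] by simp
        then have "\<bar>\<psi> (t n *\<^sub>R x) - \<psi> x\<bar> / (t n - 1) \<le> M * norm x"
          using t1[of n] by (simp add: field_simps)
        also have "\<dots> \<le> M * R" using False M by (intro mult_left_mono) auto
        finally show ?thesis using False by simp
      qed
      from mult_right_mono[OF this, of "norm x powr - p"]
      show "norm (q n x) \<le> M * (indicator (cball 0 R) x * R) * norm x powr - p"
        using t1[of n] unfolding q_def by (simp add: abs_mult)
    qed
  qed
  from LIMSEQ_unique[OF this lim1] show ?thesis
    by (simp add: I_def algebra_simps)
qed

section \<open>The weighted inequality for smooth functions\<close>

lemma norm_radial_power: "norm (norm y powr (\<kappa> - 1) *\<^sub>R y) = norm y powr \<kappa>"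
  using powr_add[of "norm y" "\<kappa> - 1" 1] by (cases "y = 0") auto

lemma continuous_radial_power:
  assumes "\<kappa> \<ge> 1"
  shows "continuous_on UNIV (\<lambda>y::'a::euclidean_space. norm y powr (\<kappa> - 1) *\<^sub>R y)"
proof -
  have "isCont (\<lambda>y::'a. norm y powr (\<kappa> - 1) *\<^sub>R y) y" for y
  proof (cases "y = 0")
    case True
    \<comment> \<open>At the origin only the norm of the product is examined: for \<kappa> = 1 the
      scalar factor alone jumps, since \<open>0 powr 0 = 0\<close>.\<close>
    have "((\<lambda>y::'a. norm y powr \<kappa>) \<longlongrightarrow> 0) (at 0)"
      using assms by (auto intro!: tendsto_eq_intros)
    then have "((\<lambda>y::'a. norm y powr (\<kappa> - 1) *\<^sub>R y) \<longlongrightarrow> 0) (at 0)"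
      by (subst tendsto_norm_zero_iff[symmetric]) (simp only: norm_radial_power)
    then show ?thesis using True by (simp add: isCont_def)
  next
    case False
    then show ?thesis by (intro continuous_intros) auto
  qed
  then show ?thesis by (simp add: continuous_at_imp_continuous_on)
qed

text \<open>Tangential directions are stretched by |y| powr (\<kappa> - 1), the radial one by
  \<kappa> times that. This ratio \<kappa> is the whole loss in the later comparison of
  gradients.\<close>

lemma has_derivative_radial_power:
  fixes y :: "'a::euclidean_space"
  assumes "y \<noteq> 0"
  shows "((\<lambda>y. norm y powr (\<kappa> - 1) *\<^sub>R y) has_derivative
    (\<lambda>h. norm y powr (\<kappa> - 1) *\<^sub>R h + ((\<kappa> - 1) * norm y powr (\<kappa> - 3) * (y \<bullet> h)) *\<^sub>R y)) (at y)"
proof -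
  have n: "(norm has_derivative (\<lambda>h. (y \<bullet> h) / norm y)) (at y)"
    using has_derivative_norm[OF assms] by (simp add: sgn_div_norm inverse_eq_divide inner_commute)
  have "((\<lambda>y. norm y powr (\<kappa> - 1)) has_derivative (\<lambda>h. (\<kappa> - 1) * norm y powr (\<kappa> - 2) * ((y \<bullet> h) / norm y))) (at y)"
  proof -
    have "((\<lambda>r. r powr (\<kappa> - 1)) has_real_derivative (\<kappa> - 1) * norm y powr (\<kappa> - 2)) (at (norm y))"
      using assms by (auto intro!: derivative_eq_intros)
    from has_derivative_compose[OF n this[unfolded has_field_derivative_def]] show ?thesis .
  qed
  moreover have "(\<kappa> - 1) * norm y powr (\<kappa> - 2) * ((y \<bullet> h) / norm y) = (\<kappa> - 1) * norm y powr (\<kappa> - 3) * (y \<bullet> h)" for h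
    using powr_add[of "norm y" "\<kappa> - 3" 1] assms by simp
  ultimately have "((\<lambda>y. norm y powr (\<kappa> - 1)) has_derivative (\<lambda>h. (\<kappa> - 1) * norm y powr (\<kappa> - 3) * (y \<bullet> h))) (at y)"
    by simp
  from has_derivative_scaleR[OF this has_derivative_ident] show ?thesis
    by (simp add: algebra_simps)
qed

text \<open>In the variable \<open>y\<close> with \<open>x = |y| powr (\<kappa> - 1) y\<close> the function \<open>exp (- \<beta> \<kappa> / 2 * |x| powr (2 / \<kappa>))\<close>
  becomes a Gaussian, and the weight \<open>|x| powr (DIM / \<kappa> - DIM)\<close> becomes constant.\<close>

lemma weighted_poincare:
  fixes \<phi> :: "'a::euclidean_space \<Rightarrow> real" and D :: "'a \<Rightarrow> 'a" and \<kappa> \<beta> :: real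
  assumes d: "\<And>x. (\<phi> has_derivative (\<lambda>h. D x \<bullet> h)) (at x)" and D: "continuous_on UNIV D"
    and k: "\<kappa> \<ge> 1"
  defines "g \<equiv> \<lambda>x::'a. exp (- (\<beta> * \<kappa> / 2) * norm x powr (2 / \<kappa>))"
    and "w \<equiv> \<lambda>x::'a. norm x powr (DIM('a) / \<kappa> - DIM('a))"
  shows "(\<integral>\<^sup>+x. \<integral>\<^sup>+y. ennreal ((\<phi> x * g y - \<phi> y * g x)\<^sup>2 * w x * w y) \<partial>lborel \<partial>lborel)
    \<le> ennreal (\<kappa> ^ 3 * pi\<^sup>2 / 4) * (\<integral>\<^sup>+(y::'a). ennreal ((norm y)\<^sup>2 * exp (- (\<beta> * \<kappa>) * (norm y)\<^sup>2)) \<partial>lborel)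
     * (\<integral>\<^sup>+x. ennreal ((norm (D x + (\<beta> * \<phi> x * norm x powr (2 / \<kappa> - 2)) *\<^sub>R x))\<^sup>2
           * norm x powr ((real DIM('a) - 2) * (1 / \<kappa> - 1))) \<partial>lborel)"
proof -
  let ?N = "real DIM('a)"
  define P where "P = (\<lambda>y::'a. norm y powr (\<kappa> - 1) *\<^sub>R y)"
  define c where "c = \<beta> * \<kappa> / 2"
  define U where "U x = D x + (\<beta> * \<phi> x * norm x powr (2 / \<kappa> - 2)) *\<^sub>R x" for x
  \<comment> \<open>The quotient of \<phi> by the profile \<open>g\<close>, in the new variable.
    Below, \<open>V\<close> is |y| powr (\<kappa> - 1) times \<open>U\<close> at \<open>P y\<close>,
    and \<open>G\<close> is the gradient of \<open>f\<close>: apart from the exponential, it is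
    \<open>V\<close> with its radial component multiplied by \<kappa>.\<close>
  define f where "f y = \<phi> (P y) * exp (c * (norm y)\<^sup>2)" for y
  define V where "V y = norm y powr (\<kappa> - 1) *\<^sub>R D (P y) + (\<beta> * \<phi> (P y)) *\<^sub>R y" for y
  define G where "G y = exp (c * (norm y)\<^sup>2) *\<^sub>R (V y + ((\<kappa> - 1) * (y \<bullet> V y) / (norm y)\<^sup>2) *\<^sub>R y)" for y
  have k0: "\<kappa> > 0" using k by simp
  have ce: "2 * c = \<beta> * \<kappa>" by (simp add: c_def)
  have cphi: "continuous_on UNIV \<phi>"
    using d by (meson continuous_at_imp_continuous_on has_derivative_continuous)
  have cP: "continuous_on UNIV P"
    unfolding P_def by (rule continuous_radial_power[OF k])
  have [measurable]: "\<phi> \<in> borel_measurable borel" "D \<in> borel_measurable borel" "P \<in> borel_measurable borel"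
    using cphi D cP by (auto intro: borel_measurable_continuous_onI)
  have [measurable]: "U \<in> borel_measurable borel" "V \<in> borel_measurable borel"
    unfolding U_def V_def by measurable
  have [measurable]: "f \<in> borel_measurable borel" "g \<in> borel_measurable borel" "w \<in> borel_measurable borel" "G \<in> borel_measurable borel"
    unfolding f_def g_def w_def G_def by measurable
  have nP: "norm (P y) = norm y powr \<kappa>" for y
    unfolding P_def by (rule norm_radial_power)
  have gP: "g (P y) = exp (- c * (norm y)\<^sup>2)" for y
    using k by (simp add: g_def nP powr_powr c_def)
  have rad: "(\<integral>\<^sup>+x. h x * ennreal (w x) \<partial>lborel) = ennreal \<kappa> * (\<integral>\<^sup>+y. h (P y) \<partial>lborel)"
    if "h \<in> borel_measurable borel" for h
    using nn_integral_radial_substitution[OF that k0] unfolding w_def P_def .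
  have cf: "continuous_on UNIV f"
    unfolding f_def by (intro continuous_intros continuous_on_compose2[OF cphi cP]) auto
  have df: "(f has_derivative (\<lambda>h. G y \<bullet> h)) (at y)" if y: "y \<noteq> 0" for y
  proof -
    have "norm y powr (\<kappa> - 1) = norm y powr (\<kappa> - 3) * (norm y)\<^sup>2"
      using y powr_add[of "norm y" "\<kappa> - 3" 2] by simp
    note pw = this
    have "((\<lambda>y. \<phi> (P y)) has_derivative (\<lambda>h. D (P y) \<bullet> (norm y powr (\<kappa> - 1) *\<^sub>R h +
        ((\<kappa> - 1) * norm y powr (\<kappa> - 3) * (y \<bullet> h)) *\<^sub>R y))) (at y)"
      using has_derivative_compose[OF has_derivative_radial_power[OF y] d] unfolding P_def .
    moreover have "((\<lambda>y::'a. exp (c * (norm y)\<^sup>2)) has_derivative (\<lambda>h. exp (c * (norm y)\<^sup>2) * (c * (2 * (y \<bullet> h))))) (at y)"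
      unfolding power2_norm_eq_inner by (auto intro!: derivative_eq_intros simp: inner_commute)
    ultimately have "(f has_derivative (\<lambda>h. \<phi> (P y) * (exp (c * (norm y)\<^sup>2) * (c * (2 * (y \<bullet> h)))) +
       (D (P y) \<bullet> (norm y powr (\<kappa> - 1) *\<^sub>R h + ((\<kappa> - 1) * norm y powr (\<kappa> - 3) * (y \<bullet> h)) *\<^sub>R y)) * exp (c * (norm y)\<^sup>2))) (at y)"
      unfolding f_def by (rule has_derivative_mult)
    moreover have "\<phi> (P y) * (exp (c * (norm y)\<^sup>2) * (c * (2 * (y \<bullet> h)))) +
       (D (P y) \<bullet> (norm y powr (\<kappa> - 1) *\<^sub>R h + ((\<kappa> - 1) * norm y powr (\<kappa> - 3) * (y \<bullet> h)) *\<^sub>R y)) * exp (c * (norm y)\<^sup>2) = G y \<bullet> h" for h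
    proof -
      \<comment> \<open>Differentiating the exponential produces 2 c = \<beta> \<kappa> times \<phi>
        y. One share \<beta> sits in \<open>V\<close>; the other (\<kappa> - 1) \<beta> is supplied
        by the additional radial stretch of that same term.\<close>
      have yV: "(y \<bullet> V y) / (norm y)\<^sup>2 = norm y powr (\<kappa> - 3) * (y \<bullet> D (P y)) + \<beta> * \<phi> (P y)"
        using y unfolding V_def pw by (simp add: inner_add_right power2_norm_eq_inner field_simps)
      have "G y \<bullet> h = exp (c * (norm y)\<^sup>2) * (V y \<bullet> h + (\<kappa> - 1) * ((y \<bullet> V y) / (norm y)\<^sup>2) * (y \<bullet> h))"
        by (simp add: G_def inner_add_left)
      then show ?thesis
        unfolding yV unfolding V_def c_def
        by (simp add: inner_add_left inner_add_right inner_commute algebra_simps)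
    qed
    ultimately show ?thesis by simp
  qed
  \<comment> \<open>The radial correction has norm at most (\<kappa> - 1) times that of
    \<open>V\<close>, which is where \<kappa> \<ge> 1 enters; the exponential in \<open>G\<close>
    cancels the Gaussian weight.\<close>
  have Gn: "(norm (G y))\<^sup>2 * exp (- (2 * c) * (norm y)\<^sup>2) \<le> \<kappa>\<^sup>2 * (norm (P y) powr (2 - 2 / \<kappa>) * (norm (U (P y)))\<^sup>2)" if y: "y \<noteq> 0" for y
  proof -
    have "V y = norm y powr (\<kappa> - 1) *\<^sub>R U (P y)"
    proof -
      have "norm (P y) powr (2 / \<kappa> - 2) = norm y powr (2 - 2 * \<kappa>)"
        using k0 by (simp add: nP powr_powr right_diff_distrib mult.commute)
      then have "norm y powr (\<kappa> - 1) * (norm (P y) powr (2 / \<kappa> - 2) * norm y powr (\<kappa> - 1)) = 1"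
        using y by (simp add: powr_add[symmetric])
      then have "(norm y powr (\<kappa> - 1) * (\<beta> * \<phi> (P y) * norm (P y) powr (2 / \<kappa> - 2))) *\<^sub>R P y = (\<beta> * \<phi> (P y)) *\<^sub>R y"
        by (simp add: P_def ac_simps)
      then show ?thesis
        by (simp add: V_def U_def scaleR_add_right)
    qed
    moreover have "norm (P y) powr (2 - 2 / \<kappa>) = (norm y powr (\<kappa> - 1))\<^sup>2"
      using k0 by (simp add: nP powr_powr right_diff_distrib power2_eq_square mult.commute flip: powr_add)
    ultimately have nV: "(norm (V y))\<^sup>2 = norm (P y) powr (2 - 2 / \<kappa>) * (norm (U (P y)))\<^sup>2"
      by (simp add: power_mult_distrib)
    have "norm (((\<kappa> - 1) * (y \<bullet> V y) / (norm y)\<^sup>2) *\<^sub>R y) \<le> (\<kappa> - 1) * norm (V y)"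
    proof -
      have "norm (((\<kappa> - 1) * (y \<bullet> V y) / (norm y)\<^sup>2) *\<^sub>R y) = (\<kappa> - 1) * (\<bar>y \<bullet> V y\<bar> / norm y)"
        using k y by (simp add: abs_mult power2_eq_square)
      also have "\<dots> \<le> (\<kappa> - 1) * norm (V y)"
        using k y Cauchy_Schwarz_ineq2[of y "V y"] by (intro mult_left_mono) (auto simp: field_simps)
      finally show ?thesis .
    qed
    then have "norm (V y + ((\<kappa> - 1) * (y \<bullet> V y) / (norm y)\<^sup>2) *\<^sub>R y) \<le> \<kappa> * norm (V y)"
      using norm_triangle_ineq[of "V y" "((\<kappa> - 1) * (y \<bullet> V y) / (norm y)\<^sup>2) *\<^sub>R y"] by (simp add: algebra_simps)
    from power_mono[OF this norm_ge_zero, of 2]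
    have "(norm (V y + ((\<kappa> - 1) * (y \<bullet> V y) / (norm y)\<^sup>2) *\<^sub>R y))\<^sup>2 \<le> \<kappa>\<^sup>2 * (norm (V y))\<^sup>2"
      by (simp only: power_mult_distrib)
    moreover have "(norm (G y))\<^sup>2 * exp (- (2 * c) * (norm y)\<^sup>2) = (norm (V y + ((\<kappa> - 1) * (y \<bullet> V y) / (norm y)\<^sup>2) *\<^sub>R y))\<^sup>2"
    proof -
      have "(exp (c * (norm y)\<^sup>2))\<^sup>2 * exp (- (2 * c) * (norm y)\<^sup>2) = 1"
        by (simp add: power2_eq_square exp_add[symmetric])
      then show ?thesis
        unfolding G_def norm_scaleR power_mult_distrib by simp
    qed
    ultimately show ?thesis by (simp add: nV)
  qed
  define M where "M = (\<integral>\<^sup>+(y::'a). ennreal ((norm y)\<^sup>2 * exp (- (\<beta> * \<kappa>) * (norm y)\<^sup>2)) \<partial>lborel)"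
  define B where "B = (\<integral>\<^sup>+x. ennreal ((norm (U x))\<^sup>2 * norm x powr ((real DIM('a) - 2) * (1 / \<kappa> - 1))) \<partial>lborel)"
  have wnn: "w x \<ge> 0" for x by (simp add: w_def)
  \<comment> \<open>Each of the two variables is substituted at the cost of one factor \<kappa>.
    Then the antisymmetric expression is the difference of the values of \<open>f\<close> times the
    product of the two profiles.\<close>
  have "(\<integral>\<^sup>+x. \<integral>\<^sup>+y. ennreal ((\<phi> x * g y - \<phi> y * g x)\<^sup>2 * w x * w y) \<partial>lborel \<partial>lborel)
      = (\<integral>\<^sup>+x. (ennreal \<kappa> * (\<integral>\<^sup>+y. ennreal ((\<phi> x * g (P y) - \<phi> (P y) * g x)\<^sup>2) \<partial>lborel)) * ennreal (w x) \<partial>lborel)"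
  proof (intro nn_integral_cong)
    fix x :: 'a
    have "(\<integral>\<^sup>+y. ennreal ((\<phi> x * g y - \<phi> y * g x)\<^sup>2 * w x * w y) \<partial>lborel)
       = (\<integral>\<^sup>+y. (ennreal ((\<phi> x * g y - \<phi> y * g x)\<^sup>2) * ennreal (w x)) * ennreal (w y) \<partial>lborel)"
      using wnn by (simp add: ennreal_mult)
    also have "\<dots> = ennreal \<kappa> * (\<integral>\<^sup>+y. ennreal ((\<phi> x * g (P y) - \<phi> (P y) * g x)\<^sup>2) * ennreal (w x) \<partial>lborel)"
      by (rule rad) measurable
    also have "\<dots> = (ennreal \<kappa> * (\<integral>\<^sup>+y. ennreal ((\<phi> x * g (P y) - \<phi> (P y) * g x)\<^sup>2) \<partial>lborel)) * ennreal (w x)"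
      by (simp add: nn_integral_multc mult.assoc)
    finally show "(\<integral>\<^sup>+y. ennreal ((\<phi> x * g y - \<phi> y * g x)\<^sup>2 * w x * w y) \<partial>lborel) = \<dots>" .
  qed
  also have "\<dots> = ennreal \<kappa> * (\<integral>\<^sup>+x. ennreal \<kappa> * (\<integral>\<^sup>+y. ennreal ((\<phi> (P x) * g (P y) - \<phi> (P y) * g (P x))\<^sup>2) \<partial>lborel) \<partial>lborel)"
    by (rule rad) measurable
  also have "\<dots> = ennreal (\<kappa>\<^sup>2) * (\<integral>\<^sup>+x. \<integral>\<^sup>+y. ennreal ((\<phi> (P x) * g (P y) - \<phi> (P y) * g (P x))\<^sup>2) \<partial>lborel \<partial>lborel)"
    using k0 by (simp add: nn_integral_cmult power2_eq_square ennreal_mult mult.assoc)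
  also have "(\<integral>\<^sup>+x. \<integral>\<^sup>+y. ennreal ((\<phi> (P x) * g (P y) - \<phi> (P y) * g (P x))\<^sup>2) \<partial>lborel \<partial>lborel)
    = (\<integral>\<^sup>+x. \<integral>\<^sup>+y. ennreal ((f x - f y)\<^sup>2 * exp (- (2 * c) * ((norm x)\<^sup>2 + (norm y)\<^sup>2))) \<partial>lborel \<partial>lborel)"
  proof (intro nn_integral_cong arg_cong[where f=ennreal])
    fix x y :: 'a
    have "exp (- (2 * c) * ((norm x)\<^sup>2 + (norm y)\<^sup>2)) = (exp (- c * (norm x)\<^sup>2) * exp (- c * (norm y)\<^sup>2))\<^sup>2"
      by (simp add: power2_eq_square exp_add[symmetric] algebra_simps)
    moreover have "(f x - f y) * (exp (- c * (norm x)\<^sup>2) * exp (- c * (norm y)\<^sup>2)) = \<phi> (P x) * g (P y) - \<phi> (P y) * g (P x)"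
      unfolding f_def gP by (simp add: exp_minus field_simps)
    ultimately show "(\<phi> (P x) * g (P y) - \<phi> (P y) * g (P x))\<^sup>2 = (f x - f y)\<^sup>2 * exp (- (2 * c) * ((norm x)\<^sup>2 + (norm y)\<^sup>2))"
      by (simp only: power_mult_distrib[symmetric])
  qed
  finally have h1: "(\<integral>\<^sup>+x. \<integral>\<^sup>+y. ennreal ((\<phi> x * g y - \<phi> y * g x)\<^sup>2 * w x * w y) \<partial>lborel \<partial>lborel) =
    ennreal (\<kappa>\<^sup>2) * (\<integral>\<^sup>+x. \<integral>\<^sup>+y. ennreal ((f x - f y)\<^sup>2 * exp (- (2 * c) * ((norm x)\<^sup>2 + (norm y)\<^sup>2))) \<partial>lborel \<partial>lborel)" .
  define E where "E = (\<integral>\<^sup>+x. ennreal ((norm (G x))\<^sup>2 * exp (- (2 * c) * (norm x)\<^sup>2)) \<partial>lborel)"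
  have h2: "(\<integral>\<^sup>+x. \<integral>\<^sup>+y. ennreal ((f x - f y)\<^sup>2 * exp (- (2 * c) * ((norm x)\<^sup>2 + (norm y)\<^sup>2))) \<partial>lborel \<partial>lborel)
     \<le> ennreal (pi\<^sup>2 / 4) * M * E"
    unfolding M_def E_def ce[symmetric] by (rule gaussian_poincare[OF cf _ df]) measurable
  have "E \<le> (\<integral>\<^sup>+x. ennreal (\<kappa>\<^sup>2) * ennreal (norm (P x) powr (2 - 2 / \<kappa>) * (norm (U (P x)))\<^sup>2) \<partial>lborel)"
    unfolding E_def
    by (rule nn_integral_mono_AE, use AE_lborel_singleton[of "0::'a"] in eventually_elim)
       (use Gn in \<open>simp flip: ennreal_mult\<close>)
  \<comment> \<open>Of the two factors \<kappa> from the gradient bound one is used up by undoing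
    the substitution. The other joins the square from the double integral, which explains the cube
    in the constant.\<close>
  also have "\<dots> = ennreal \<kappa> * (ennreal \<kappa> * (\<integral>\<^sup>+x. ennreal (norm (P x) powr (2 - 2 / \<kappa>) * (norm (U (P x)))\<^sup>2) \<partial>lborel))"
    using k0 by (simp add: nn_integral_cmult power2_eq_square ennreal_mult mult.assoc)
  also have "ennreal \<kappa> * (\<integral>\<^sup>+x. ennreal (norm (P x) powr (2 - 2 / \<kappa>) * (norm (U (P x)))\<^sup>2) \<partial>lborel)
     = (\<integral>\<^sup>+x. ennreal (norm x powr (2 - 2 / \<kappa>) * (norm (U x))\<^sup>2) * ennreal (w x) \<partial>lborel)"
    by (rule rad[symmetric]) measurable
  also have "\<dots> = B"
    unfolding B_def
  proof (intro nn_integral_cong)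
    fix x :: 'a
    have "norm x powr (2 - 2 / \<kappa>) * w x = norm x powr ((?N - 2) * (1 / \<kappa> - 1))"
      unfolding w_def powr_add[symmetric] by (simp add: algebra_simps)
    then have "norm x powr (2 - 2 / \<kappa>) * (norm (U x))\<^sup>2 * w x = (norm (U x))\<^sup>2 * norm x powr ((?N - 2) * (1 / \<kappa> - 1))"
      by (simp add: ac_simps)
    then show "ennreal (norm x powr (2 - 2 / \<kappa>) * (norm (U x))\<^sup>2) * ennreal (w x)
       = ennreal ((norm (U x))\<^sup>2 * norm x powr ((?N - 2) * (1 / \<kappa> - 1)))"
      by (simp add: wnn flip: ennreal_mult)
  qed
  finally have h3: "E \<le> ennreal \<kappa> * B" .
  have "ennreal (\<kappa>\<^sup>2) * (ennreal (pi\<^sup>2 / 4) * M * E) \<le> ennreal (\<kappa>\<^sup>2) * (ennreal (pi\<^sup>2 / 4) * M * (ennreal \<kappa> * B))"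
    by (intro mult_left_mono h3) auto
  also have "\<dots> = (ennreal (\<kappa>\<^sup>2) * ennreal (pi\<^sup>2 / 4) * ennreal \<kappa>) * M * B"
    by (simp only: ac_simps)
  also have "ennreal (\<kappa>\<^sup>2) * ennreal (pi\<^sup>2 / 4) * ennreal \<kappa> = ennreal (\<kappa> ^ 3 * pi\<^sup>2 / 4)"
    using k0 by (simp add: power2_eq_square power3_eq_cube ac_simps flip: ennreal_mult)
  finally have "ennreal (\<kappa>\<^sup>2) * (ennreal (pi\<^sup>2 / 4) * M * E) \<le> ennreal (\<kappa> ^ 3 * pi\<^sup>2 / 4) * M * B" .
  moreover have "(\<integral>\<^sup>+x. \<integral>\<^sup>+y. ennreal ((\<phi> x * g y - \<phi> y * g x)\<^sup>2 * w x * w y) \<partial>lborel \<partial>lborel)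
     \<le> ennreal (\<kappa>\<^sup>2) * (ennreal (pi\<^sup>2 / 4) * M * E)"
    unfolding h1 by (intro mult_left_mono h2) auto
  ultimately show ?thesis
    unfolding M_def B_def U_def by (rule order_trans[rotated])
qed

text \<open>Expand the square. The exponents match: multiplying the gradient weight by |x| powr (2 /
  \<kappa> - 2) once gives the weight of the cross term, and by its square times |x|^2 the weight of
  the last term. The cross term is a radial derivative of \<phi>^2, which the dilation identity
  integrates; its negative value is moved to the left.\<close>

lemma weighted_energy_identity:
  fixes \<phi> :: "'a::euclidean_space \<Rightarrow> real" and D :: "'a \<Rightarrow> 'a" and \<kappa> \<beta> R :: real
  assumes d: "\<And>x. (\<phi> has_derivative (\<lambda>h. D x \<bullet> h)) (at x)" and D: "continuous_on UNIV D"
    and R: "\<And>x. norm x > R \<Longrightarrow> \<phi> x = 0" and k: "\<kappa> \<ge> 1" and b: "\<beta> \<ge> 0" and N2: "DIM('a) \<ge> 2"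
  defines "N \<equiv> real DIM('a)"
  shows "(\<integral>\<^sup>+x. ennreal ((norm (D x + (\<beta> * \<phi> x * norm x powr (2 / \<kappa> - 2)) *\<^sub>R x))\<^sup>2
           * norm x powr ((N - 2) * (1 / \<kappa> - 1))) \<partial>lborel)
      + ennreal (\<beta> * N / \<kappa>) * (\<integral>\<^sup>+x. ennreal ((\<phi> x)\<^sup>2 * norm x powr (N / \<kappa> - N)) \<partial>lborel)
    = (\<integral>\<^sup>+x. ennreal ((norm (D x))\<^sup>2 * norm x powr ((N - 2) * (1 / \<kappa> - 1))) \<partial>lborel)
      + ennreal (\<beta>\<^sup>2) * (\<integral>\<^sup>+x. ennreal ((\<phi> x)\<^sup>2 * norm x powr ((N + 2) * (1 / \<kappa> - 1) + 2)) \<partial>lborel)"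
proof -
  let ?U = "\<lambda>x. D x + (\<beta> * \<phi> x * norm x powr (2 / \<kappa> - 2)) *\<^sub>R x"
  define eB where "eB = (N - 2) * (1 / \<kappa> - 1)"
  define eG where "eG = N / \<kappa> - N"
  define eA where "eA = (N + 2) * (1 / \<kappa> - 1) + 2"
  define \<mu> where "\<mu> = 1 / \<kappa>"
  have mu: "\<mu> > 0" "\<mu> \<le> 1" using k by (auto simp: \<mu>_def)
  have N: "N \<ge> 2" using N2 by (simp add: N_def)
  have e_mu: "eB = (N - 2) * (\<mu> - 1)" "eG = N * (\<mu> - 1)" "eA = (N + 2) * (\<mu> - 1) + 2"
    by (auto simp: eB_def eG_def eA_def \<mu>_def algebra_simps)
  \<comment> \<open>All three exponents turn out larger than - DIM, so each term of the expanded
    square is integrable by itself.\<close>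
  have "N * \<mu> \<ge> 2 * \<mu>"
    using mu N by (intro mult_right_mono) auto
  moreover have "eG = N * \<mu> - N" "eB = N * \<mu> - N - 2 * \<mu> + 2" "eA = N * \<mu> - N + 2 * \<mu>"
    unfolding e_mu by (auto simp: algebra_simps)
  ultimately have eN: "- eG < real DIM('a)" "- eB < real DIM('a)" "- eA < real DIM('a)"
    using mu unfolding N_def[symmetric] by linarith+
  have cphi: "continuous_on UNIV \<phi>"
    using d by (meson continuous_at_imp_continuous_on has_derivative_continuous)
  have D0: "norm x > R \<Longrightarrow> D x = 0" for x
    using gradient_outside_support[OF d R] by blast
  have iG: "integrable lborel (\<lambda>x. (\<phi> x)\<^sup>2 * norm x powr - (- eG))"
    by (rule integrable_norm_powr_weight[OF _ _ eN(1)]) (auto intro!: continuous_intros cphi R)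
  have iA: "integrable lborel (\<lambda>x. (\<phi> x)\<^sup>2 * norm x powr - (- eA))"
    by (rule integrable_norm_powr_weight[OF _ _ eN(3)]) (auto intro!: continuous_intros cphi R)
  have iB: "integrable lborel (\<lambda>x. (norm (D x))\<^sup>2 * norm x powr - (- eB))"
    by (rule integrable_norm_powr_weight[OF _ _ eN(2)]) (auto intro!: continuous_intros D D0)
  have iX: "integrable lborel (\<lambda>x. (\<phi> x * (D x \<bullet> x)) * norm x powr - (- eG))"
    by (rule integrable_norm_powr_weight[OF _ _ eN(1)]) (auto intro!: continuous_intros cphi D R)
  have X: "(\<integral>x. (\<phi> x * (D x \<bullet> x)) * norm x powr - (- eG) \<partial>lborel) = - (N / \<kappa> / 2) * (\<integral>x. (\<phi> x)\<^sup>2 * norm x powr - (- eG) \<partial>lborel)"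
  proof -
    have dd: "((\<lambda>x. (\<phi> x)\<^sup>2) has_derivative (\<lambda>h. ((2 * \<phi> x) *\<^sub>R D x) \<bullet> h)) (at x)" for x
      using has_derivative_mult[OF d[of x] d[of x]] by (simp add: power2_eq_square algebra_simps)
    \<comment> \<open>The dilation identity for \<phi>^2 with p = - eG, for which DIM - p = N /
      \<kappa>.\<close>
    have "(\<integral>x. (((2 * \<phi> x) *\<^sub>R D x) \<bullet> x) * norm x powr - (- eG) \<partial>lborel) = - (real DIM('a) - (- eG)) * (\<integral>x. (\<phi> x)\<^sup>2 * norm x powr - (- eG) \<partial>lborel)"
      by (rule integral_radial_derivative[OF dd _ _ eN(1), of R]) (auto intro!: continuous_intros cphi D R)
    moreover have "(\<integral>x. (((2 * \<phi> x) *\<^sub>R D x) \<bullet> x) * norm x powr - (- eG) \<partial>lborel) = 2 * (\<integral>x. (\<phi> x * (D x \<bullet> x)) * norm x powr - (- eG) \<partial>lborel)"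
      by (subst integral_mult_right_zero[symmetric], intro Bochner_Integration.integral_cong) (auto simp: ac_simps)
    moreover have "real DIM('a) - (- eG) = N / \<kappa>"
      by (simp add: eG_def N_def)
    ultimately have "2 * (\<integral>x. (\<phi> x * (D x \<bullet> x)) * norm x powr - (- eG) \<partial>lborel) = - (N / \<kappa>) * (\<integral>x. (\<phi> x)\<^sup>2 * norm x powr - (- eG) \<partial>lborel)"
      by (simp only:)
    then show ?thesis
      by simp
  qed
  define Y where "Y x = (norm (D x))\<^sup>2 * norm x powr - (- eB) + \<beta>\<^sup>2 * ((\<phi> x)\<^sup>2 * norm x powr - (- eA))
      + 2 * \<beta> * ((\<phi> x * (D x \<bullet> x)) * norm x powr - (- eG))" for x
  have iY: "integrable lborel Y"
    unfolding Y_def using iA iB iX by simp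
  have UY: "AE x in lborel. (norm (?U x))\<^sup>2 * norm x powr eB = Y x"
    using AE_lborel_singleton[of "0::'a"]
  proof eventually_elim
    case (elim x)
    define r where "r = norm x powr (2 / \<kappa> - 2)"
    have r2: "norm x powr eB * r\<^sup>2 * (norm x)\<^sup>2 = norm x powr eA"
    proof -
      have "(norm x)\<^sup>2 = norm x powr 2" using elim by simp
      then have "norm x powr eB * r\<^sup>2 * (norm x)\<^sup>2 = norm x powr (eB + ((2 / \<kappa> - 2) + (2 / \<kappa> - 2)) + 2)"
        unfolding r_def power2_eq_square[of "_ powr _"] by (simp only: powr_add)
      also have "eB + ((2 / \<kappa> - 2) + (2 / \<kappa> - 2)) + 2 = eA"
        by (simp add: eB_def eA_def algebra_simps)
      finally show ?thesis .
    qed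
    have r1: "norm x powr eB * r = norm x powr eG"
    proof -
      have "norm x powr eB * r = norm x powr (eB + (2 / \<kappa> - 2))"
        unfolding r_def by (simp only: powr_add)
      also have "eB + (2 / \<kappa> - 2) = eG"
        by (simp add: eB_def eG_def algebra_simps)
      finally show ?thesis .
    qed
    have "(norm (?U x))\<^sup>2 = (norm (D x))\<^sup>2 + 2 * \<beta> * \<phi> x * r * (D x \<bullet> x) + \<beta>\<^sup>2 * (\<phi> x)\<^sup>2 * r\<^sup>2 * (norm x)\<^sup>2"
      unfolding power2_norm_eq_inner r_def[symmetric]
      by (simp add: inner_add_left inner_add_right inner_commute power2_eq_square algebra_simps)
    then show ?case
      unfolding Y_def minus_minus r1[symmetric] r2[symmetric] by (simp add: algebra_simps)
  qed
  have Ynn: "AE x in lborel. 0 \<le> Y x"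
    using UY
  proof eventually_elim
    case (elim x)
    show ?case unfolding elim[symmetric] by simp
  qed
  have "(\<integral>\<^sup>+x. ennreal ((norm (?U x))\<^sup>2 * norm x powr eB) \<partial>lborel) = (\<integral>\<^sup>+x. ennreal (Y x) \<partial>lborel)"
    by (rule nn_integral_cong_AE, use UY in eventually_elim) simp
  also have "\<dots> = ennreal (\<integral>x. Y x \<partial>lborel)"
    by (rule nn_integral_eq_integral[OF iY Ynn])
  finally have U: "(\<integral>\<^sup>+x. ennreal ((norm (?U x))\<^sup>2 * norm x powr eB) \<partial>lborel) = ennreal (\<integral>x. Y x \<partial>lborel)" .
  have Y0: "(\<integral>x. Y x \<partial>lborel) \<ge> 0"
    by (rule integral_nonneg_AE[OF Ynn])
  have G: "(\<integral>\<^sup>+x. ennreal ((\<phi> x)\<^sup>2 * norm x powr eG) \<partial>lborel) = ennreal (\<integral>x. (\<phi> x)\<^sup>2 * norm x powr eG \<partial>lborel)"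
    using iG by (intro nn_integral_eq_integral) auto
  have A: "(\<integral>\<^sup>+x. ennreal ((\<phi> x)\<^sup>2 * norm x powr eA) \<partial>lborel) = ennreal (\<integral>x. (\<phi> x)\<^sup>2 * norm x powr eA \<partial>lborel)"
    using iA by (intro nn_integral_eq_integral) auto
  have B: "(\<integral>\<^sup>+x. ennreal ((norm (D x))\<^sup>2 * norm x powr eB) \<partial>lborel) = ennreal (\<integral>x. (norm (D x))\<^sup>2 * norm x powr eB \<partial>lborel)"
    using iB by (intro nn_integral_eq_integral) auto
  have "(\<integral>x. Y x \<partial>lborel) = (\<integral>x. (norm (D x))\<^sup>2 * norm x powr eB \<partial>lborel) + \<beta>\<^sup>2 * (\<integral>x. (\<phi> x)\<^sup>2 * norm x powr eA \<partial>lborel)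
      - \<beta> * N / \<kappa> * (\<integral>x. (\<phi> x)\<^sup>2 * norm x powr eG \<partial>lborel)"
    unfolding Y_def using iA iB iX X by simp
  then have "(\<integral>x. Y x \<partial>lborel) + \<beta> * N / \<kappa> * (\<integral>x. (\<phi> x)\<^sup>2 * norm x powr eG \<partial>lborel) =
      (\<integral>x. (norm (D x))\<^sup>2 * norm x powr eB \<partial>lborel) + \<beta>\<^sup>2 * (\<integral>x. (\<phi> x)\<^sup>2 * norm x powr eA \<partial>lborel)"
    by simp
  then have "ennreal (\<integral>x. Y x \<partial>lborel) + ennreal (\<beta> * N / \<kappa>) * ennreal (\<integral>x. (\<phi> x)\<^sup>2 * norm x powr eG \<partial>lborel) =
      ennreal (\<integral>x. (norm (D x))\<^sup>2 * norm x powr eB \<partial>lborel) + ennreal (\<beta>\<^sup>2) * ennreal (\<integral>x. (\<phi> x)\<^sup>2 * norm x powr eA \<partial>lborel)"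
    using k b N Y0 by (simp flip: ennreal_mult ennreal_plus)
  then show ?thesis
    unfolding U[symmetric] G[symmetric] A[symmetric] B[symmetric] unfolding eA_def eB_def eG_def .
qed

text \<open>The subtracted term stays on the left as a summand. In this form the inequality makes
  sense in \<open>ennreal\<close> without any finiteness assumption, and it is ready for Fatou on
  the left.\<close>

lemma weighted_stability_smooth:
  fixes \<phi> :: "'a::euclidean_space \<Rightarrow> real" and D :: "'a \<Rightarrow> 'a" and \<kappa> \<beta> R :: real
  assumes d: "\<And>x. (\<phi> has_derivative (\<lambda>h. D x \<bullet> h)) (at x)" and D: "continuous_on UNIV D"
    and R: "\<And>x. norm x > R \<Longrightarrow> \<phi> x = 0" and k: "\<kappa> \<ge> 1" and b: "\<beta> \<ge> 0" and N2: "DIM('a) \<ge> 2"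
  defines "N \<equiv> real DIM('a)"
  defines "g \<equiv> \<lambda>x::'a. exp (- (\<beta> * \<kappa> / 2) * norm x powr (2 / \<kappa>))"
    and "w \<equiv> \<lambda>x::'a. norm x powr (N / \<kappa> - N)"
    and "K \<equiv> ennreal (\<kappa> ^ 3 * pi\<^sup>2 / 4) * (\<integral>\<^sup>+(y::'a). ennreal ((norm y)\<^sup>2 * exp (- (\<beta> * \<kappa>) * (norm y)\<^sup>2)) \<partial>lborel)"
  shows "(\<integral>\<^sup>+x. \<integral>\<^sup>+y. ennreal ((\<phi> x * g y - \<phi> y * g x)\<^sup>2 * w x * w y) \<partial>lborel \<partial>lborel)
      + K * (ennreal (\<beta> * N / \<kappa>) * (\<integral>\<^sup>+x. ennreal ((\<phi> x)\<^sup>2 * w x) \<partial>lborel))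
    \<le> K * ((\<integral>\<^sup>+x. ennreal ((norm (D x))\<^sup>2 * norm x powr ((N - 2) * (1 / \<kappa> - 1))) \<partial>lborel)
      + ennreal (\<beta>\<^sup>2) * (\<integral>\<^sup>+x. ennreal ((\<phi> x)\<^sup>2 * norm x powr ((N + 2) * (1 / \<kappa> - 1) + 2)) \<partial>lborel))"
proof -
  let ?U = "\<integral>\<^sup>+x. ennreal ((norm (D x + (\<beta> * \<phi> x * norm x powr (2 / \<kappa> - 2)) *\<^sub>R x))\<^sup>2
           * norm x powr ((N - 2) * (1 / \<kappa> - 1))) \<partial>lborel"
  let ?G = "ennreal (\<beta> * N / \<kappa>) * (\<integral>\<^sup>+x. ennreal ((\<phi> x)\<^sup>2 * w x) \<partial>lborel)"
  have "(\<integral>\<^sup>+x. \<integral>\<^sup>+y. ennreal ((\<phi> x * g y - \<phi> y * g x)\<^sup>2 * w x * w y) \<partial>lborel \<partial>lborel) + K * ?G \<le> K * ?U + K * ?G"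
    unfolding N_def w_def g_def K_def by (intro add_right_mono weighted_poincare d D k)
  also have "\<dots> = K * (?U + ?G)"
    by (rule distrib_left[symmetric])
  also have "?U + ?G = (\<integral>\<^sup>+x. ennreal ((norm (D x))\<^sup>2 * norm x powr ((N - 2) * (1 / \<kappa> - 1))) \<partial>lborel)
      + ennreal (\<beta>\<^sup>2) * (\<integral>\<^sup>+x. ennreal ((\<phi> x)\<^sup>2 * norm x powr ((N + 2) * (1 / \<kappa> - 1) + 2)) \<partial>lborel)"
    unfolding N_def w_def by (rule weighted_energy_identity[OF d D R k b N2])
  finally show ?thesis .
qed

text \<open>Fatou in the inner and then in the outer variable. Only the approximants are assumed
  measurable, since the limit \<open>h\<close> will be built from a function that is merely Lebesgue
  measurable.\<close>

lemma nn_integral_pair_Fatou: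
  fixes h :: "'a::euclidean_space \<Rightarrow> 'a \<Rightarrow> ennreal"
  assumes [measurable]: "\<And>n. (\<lambda>(x, y). f n x y) \<in> borel_measurable (borel \<Otimes>\<^sub>M borel)"
    and lim: "AE x in lborel. AE y in lborel. (\<lambda>n. f n x y) \<longlonglongrightarrow> h x y"
  shows "(\<integral>\<^sup>+x. \<integral>\<^sup>+y. h x y \<partial>lborel \<partial>lborel) \<le> liminf (\<lambda>n. \<integral>\<^sup>+x. \<integral>\<^sup>+y. f n x y \<partial>lborel \<partial>lborel)"
proof -
  have "(\<integral>\<^sup>+x. \<integral>\<^sup>+y. h x y \<partial>lborel \<partial>lborel) \<le> (\<integral>\<^sup>+x. liminf (\<lambda>n. \<integral>\<^sup>+y. f n x y \<partial>lborel) \<partial>lborel)"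
  proof (rule nn_integral_mono_AE, use lim in eventually_elim)
    fix x assume x: "AE y in lborel. (\<lambda>n. f n x y) \<longlonglongrightarrow> h x y"
    have "(\<integral>\<^sup>+y. h x y \<partial>lborel) = (\<integral>\<^sup>+y. liminf (\<lambda>n. f n x y) \<partial>lborel)"
      by (rule nn_integral_cong_AE, use x in eventually_elim) (simp add: lim_imp_Liminf)
    also have "\<dots> \<le> liminf (\<lambda>n. \<integral>\<^sup>+y. f n x y \<partial>lborel)"
      by (rule nn_integral_liminf) measurable
    finally show "(\<integral>\<^sup>+y. h x y \<partial>lborel) \<le> liminf (\<lambda>n. \<integral>\<^sup>+y. f n x y \<partial>lborel)" .
  qed
  also have "\<dots> \<le> liminf (\<lambda>n. \<integral>\<^sup>+x. \<integral>\<^sup>+y. f n x y \<partial>lborel \<partial>lborel)"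
    by (rule nn_integral_liminf) measurable
  finally show ?thesis .
qed

section \<open>Passage to the closure\<close>

text \<open>Fatou's lemma for counting measure on a space of two points.\<close>

lemma liminf_add_ennreal:
  fixes a b :: "nat \<Rightarrow> ennreal"
  shows "liminf a + liminf b \<le> liminf (\<lambda>n. a n + b n)"
proof -
  let ?f = "\<lambda>n c. if c then a n else b n"
  have "(\<integral>\<^sup>+c. liminf (\<lambda>n. ?f n c) \<partial>count_space UNIV) \<le> liminf (\<lambda>n. \<integral>\<^sup>+c. ?f n c \<partial>count_space UNIV)"
    by (rule nn_integral_liminf) simp
  then show ?thesis
    by (simp add: nn_integral_count_space_finite UNIV_bool add.commute)
qed

text \<open>Young's inequality (p + q)^2 \<le> (1 + \<epsilon>) p^2 + (1 + 1 / \<epsilon>) q^2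
  replaces the triangle inequality of the weighted norm: it stays linear in the integrals, and
  \<epsilon> can be sent to 0 after the approximation has converged.\<close>

lemma nn_integral_weighted_square_perturb:
  fixes u v :: "'a \<Rightarrow> 'b::{real_normed_vector, second_countable_topology}"
  assumes [measurable]: "u \<in> borel_measurable M" "v \<in> borel_measurable M" "w \<in> borel_measurable M"
    and w: "\<And>x. w x \<ge> 0" and e: "\<epsilon> > 0"
  shows "(\<integral>\<^sup>+x. ennreal ((norm (v x))\<^sup>2 * w x) \<partial>M) \<le>
     ennreal (1 + \<epsilon>) * (\<integral>\<^sup>+x. ennreal ((norm (u x))\<^sup>2 * w x) \<partial>M) +
     ennreal (1 + 1 / \<epsilon>) * (\<integral>\<^sup>+x. ennreal ((norm (u x - v x))\<^sup>2 * w x) \<partial>M)"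
proof -
  have "(norm (v x))\<^sup>2 * w x \<le> (1 + \<epsilon>) * ((norm (u x))\<^sup>2 * w x) + (1 + 1 / \<epsilon>) * ((norm (u x - v x))\<^sup>2 * w x)" for x
  proof -
    define p q where "p = norm (u x)" and "q = norm (u x - v x)"
    have "norm (v x) \<le> p + q"
      unfolding p_def q_def using norm_triangle_ineq4[of "u x" "u x - v x"] by simp
    then have "(norm (v x))\<^sup>2 \<le> (p + q)\<^sup>2"
      by (intro power_mono) auto
    also have "\<dots> \<le> (1 + \<epsilon>) * p\<^sup>2 + (1 + 1 / \<epsilon>) * q\<^sup>2"
    proof -
      have "0 \<le> (\<epsilon> * p - q)\<^sup>2 / \<epsilon>" using e by simp
      also have "\<dots> = \<epsilon> * p\<^sup>2 - 2 * p * q + q\<^sup>2 / \<epsilon>"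
        using e by (simp add: power2_eq_square field_simps)
      finally show ?thesis by (simp add: power2_eq_square algebra_simps)
    qed
    finally show ?thesis
      using mult_right_mono[OF _ w[of x]] unfolding p_def q_def by (fastforce simp: algebra_simps)
  qed
  then have "(\<integral>\<^sup>+x. ennreal ((norm (v x))\<^sup>2 * w x) \<partial>M) \<le>
     (\<integral>\<^sup>+x. ennreal ((1 + \<epsilon>) * ((norm (u x))\<^sup>2 * w x) + (1 + 1 / \<epsilon>) * ((norm (u x - v x))\<^sup>2 * w x)) \<partial>M)"
    by (intro nn_integral_mono ennreal_leI)
  also have "\<dots> = (\<integral>\<^sup>+x. ennreal (1 + \<epsilon>) * ennreal ((norm (u x))\<^sup>2 * w x) + ennreal (1 + 1 / \<epsilon>) * ennreal ((norm (u x - v x))\<^sup>2 * w x) \<partial>M)"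
    using w e by (intro nn_integral_cong) (simp add: ennreal_plus ennreal_mult)
  also have "\<dots> = ennreal (1 + \<epsilon>) * (\<integral>\<^sup>+x. ennreal ((norm (u x))\<^sup>2 * w x) \<partial>M) +
     ennreal (1 + 1 / \<epsilon>) * (\<integral>\<^sup>+x. ennreal ((norm (u x - v x))\<^sup>2 * w x) \<partial>M)"
    by (subst nn_integral_add) (auto simp: nn_integral_cmult)
  finally show ?thesis .
qed

lemma weighted_L2_AE_subseq:
  fixes u :: "'a::euclidean_space \<Rightarrow> real" and \<psi> :: "nat \<Rightarrow> 'a \<Rightarrow> real"
  assumes [measurable]: "u \<in> borel_measurable lebesgue" "\<And>k. \<psi> k \<in> borel_measurable lebesgue" "w \<in> borel_measurable lebesgue"
    and w: "\<And>x. w x \<ge> 0" "AE x in lborel. w x > 0"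
    and lim: "(\<lambda>k. \<integral>\<^sup>+x. ennreal (\<bar>u x - \<psi> k x\<bar>\<^sup>2 * w x) \<partial>lebesgue) \<longlonglongrightarrow> 0"
  shows "\<exists>r::nat \<Rightarrow> nat. strict_mono r \<and> (AE x in lborel. (\<lambda>k. \<psi> (r k) x) \<longlonglongrightarrow> u x)"
proof -
  define v where "v k x = \<bar>u x - \<psi> k x\<bar>\<^sup>2 * w x" for k x
  have vnn: "v k x \<ge> 0" for k x using w by (simp add: v_def)
  have [measurable]: "v k \<in> borel_measurable lebesgue" for k unfolding v_def by measurable
  have lim': "(\<lambda>k. \<integral>\<^sup>+x. ennreal (v k x) \<partial>lebesgue) \<longlonglongrightarrow> 0"
    using lim by (simp add: v_def)
  \<comment> \<open>Finitely many initial integrals may be infinite. Shifting by \<open>k0\<close>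
    leaves integrable functions, to which the subsequence theorem for L1 convergence
    applies.\<close>
  then have "eventually (\<lambda>k. (\<integral>\<^sup>+x. ennreal (v k x) \<partial>lebesgue) < 1) sequentially"
    by (rule order_tendstoD) simp
  then obtain k0 where k0: "\<And>k. k \<ge> k0 \<Longrightarrow> (\<integral>\<^sup>+x. ennreal (v k x) \<partial>lebesgue) < 1"
    by (auto simp: eventually_sequentially)
  have int: "integrable lebesgue (v (k + k0))" for k
    using k0[of "k + k0"] vnn by (intro integrableI_nonneg) (auto intro: order_less_trans)
  have "(\<lambda>k. enn2real (\<integral>\<^sup>+x. ennreal (v (k + k0) x) \<partial>lebesgue)) \<longlonglongrightarrow> 0"
    using LIMSEQ_ignore_initial_segment[OF lim', of k0] by (intro tendsto_enn2real) auto
  then have "(\<lambda>k. \<integral>x. norm (v (k + k0) x) \<partial>lebesgue) \<longlonglongrightarrow> 0"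
    using vnn by (simp add: integral_eq_nn_integral)
  from tendsto_L1_AE_subseq[OF int this] obtain r :: "nat \<Rightarrow> nat"
    where r: "strict_mono r" "AE x in lebesgue. (\<lambda>n. v (r n + k0) x) \<longlonglongrightarrow> 0"
    by blast
  have "AE x in lborel. (\<lambda>n. v (r n + k0) x) \<longlonglongrightarrow> 0"
    using r(2) by (simp add: AE_completion_iff)
  then have "AE x in lborel. (\<lambda>k. \<psi> (r k + k0) x) \<longlonglongrightarrow> u x"
    using w(2)
  proof eventually_elim
    case (elim x)
    \<comment> \<open>Positivity of the weight almost everywhere allows it to be divided out
      pointwise.\<close>
    have "(\<lambda>n. v (r n + k0) x / w x) \<longlonglongrightarrow> 0 / w x"
      using elim by (intro tendsto_divide tendsto_const) auto
    then have "(\<lambda>n. (u x - \<psi> (r n + k0) x)\<^sup>2) \<longlonglongrightarrow> 0"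
      using elim by (simp add: v_def)
    from tendsto_real_sqrt[OF this] have "(\<lambda>n. \<bar>u x - \<psi> (r n + k0) x\<bar>) \<longlonglongrightarrow> 0" by simp
    then have "(\<lambda>n. u x - (u x - \<psi> (r n + k0) x)) \<longlonglongrightarrow> u x - 0"
      by (intro tendsto_diff tendsto_const) (simp only: tendsto_rabs_zero_iff)
    then show ?case by simp
  qed
  moreover have "strict_mono (\<lambda>k. r k + k0)"
    using r(1) by (auto simp: strict_mono_def)
  ultimately show ?thesis by blast
qed

text \<open>Every term on the left is lower semicontinuous by Fatou's lemma, the right-hand side is continuous.\<close>

lemma weighted_stability_closure:
  fixes u :: "'a::euclidean_space \<Rightarrow> real" and Du :: "'a \<Rightarrow> 'a"
    and \<psi> :: "nat \<Rightarrow> 'a \<Rightarrow> real" and D\<psi> :: "nat \<Rightarrow> 'a \<Rightarrow> 'a"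
  assumes u [measurable]: "u \<in> borel_measurable lebesgue" and Du [measurable]: "Du \<in> borel_measurable lebesgue"
    and m [measurable]: "\<And>k. \<psi> k \<in> borel_measurable borel" "\<And>k. D\<psi> k \<in> borel_measurable borel"
    and g [measurable]: "g \<in> borel_measurable borel"
    and wm [measurable]: "w \<in> borel_measurable borel" "wA \<in> borel_measurable borel" "wB \<in> borel_measurable borel"
    and w: "\<And>x. w x \<ge> 0" "\<And>x. wA x \<ge> 0" "\<And>x. wB x \<ge> 0" "AE x in lborel. wA x > 0"
    and K: "K < top"
    and ineq: "\<And>k. (\<integral>\<^sup>+x. \<integral>\<^sup>+y. ennreal ((\<psi> k x * g y - \<psi> k y * g x)\<^sup>2 * w x * w y) \<partial>lborel \<partial>lborel)
        + K * (ennreal c * (\<integral>\<^sup>+x. ennreal ((\<psi> k x)\<^sup>2 * w x) \<partial>lborel))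
      \<le> K * ((\<integral>\<^sup>+x. ennreal ((norm (D\<psi> k x))\<^sup>2 * wB x) \<partial>lborel) + ennreal d * (\<integral>\<^sup>+x. ennreal ((\<psi> k x)\<^sup>2 * wA x) \<partial>lborel))"
    and lim: "(\<lambda>k. (\<integral>\<^sup>+x. ennreal ((norm (Du x - D\<psi> k x))\<^sup>2 * wB x) \<partial>lebesgue) + (\<integral>\<^sup>+x. ennreal (\<bar>u x - \<psi> k x\<bar>\<^sup>2 * wA x) \<partial>lebesgue)) \<longlonglongrightarrow> 0"
    and fin: "(\<integral>\<^sup>+x. ennreal ((norm (Du x))\<^sup>2 * wB x) \<partial>lebesgue) + (\<integral>\<^sup>+x. ennreal (\<bar>u x\<bar>\<^sup>2 * wA x) \<partial>lebesgue) < \<infinity>"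
  shows "(\<integral>\<^sup>+x. \<integral>\<^sup>+y. ennreal ((u x * g y - u y * g x)\<^sup>2 * w x * w y) \<partial>lebesgue \<partial>lebesgue)
        + K * (ennreal c * (\<integral>\<^sup>+x. ennreal ((u x)\<^sup>2 * w x) \<partial>lebesgue))
      \<le> K * ((\<integral>\<^sup>+x. ennreal ((norm (Du x))\<^sup>2 * wB x) \<partial>lebesgue) + ennreal d * (\<integral>\<^sup>+x. ennreal (\<bar>u x\<bar>\<^sup>2 * wA x) \<partial>lebesgue))"
    (is "?D + K * (ennreal c * ?G) \<le> K * (?B + ennreal d * ?A)")
proof -
  have [measurable]: "\<psi> k \<in> borel_measurable lebesgue" "D\<psi> k \<in> borel_measurable lebesgue"
     "w \<in> borel_measurable lebesgue" "wA \<in> borel_measurable lebesgue" "wB \<in> borel_measurable lebesgue" for k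
    using m wm by (auto intro: measurable_completion)
  define a where "a k = (\<integral>\<^sup>+x. ennreal (\<bar>u x - \<psi> k x\<bar>\<^sup>2 * wA x) \<partial>lebesgue)" for k
  define b where "b k = (\<integral>\<^sup>+x. ennreal ((norm (Du x - D\<psi> k x))\<^sup>2 * wB x) \<partial>lebesgue)" for k
  have alim: "a \<longlonglongrightarrow> 0"
    by (rule tendsto_sandwich[OF _ _ tendsto_const lim[folded a_def b_def]]) auto
  have blim: "b \<longlonglongrightarrow> 0"
    by (rule tendsto_sandwich[OF _ _ tendsto_const lim[folded a_def b_def]]) auto
  from weighted_L2_AE_subseq[OF u _ _ w(2) w(4) alim[unfolded a_def]]
  obtain r :: "nat \<Rightarrow> nat" where r: "strict_mono r" and ae: "AE x in lborel. (\<lambda>k. \<psi> (r k) x) \<longlonglongrightarrow> u x"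
    by auto
  define Q where "Q k = (\<integral>\<^sup>+x. ennreal ((norm (D\<psi> k x))\<^sup>2 * wB x) \<partial>lborel) + ennreal d * (\<integral>\<^sup>+x. ennreal ((\<psi> k x)\<^sup>2 * wA x) \<partial>lborel)" for k
  define L where "L k = (\<integral>\<^sup>+x. \<integral>\<^sup>+y. ennreal ((\<psi> k x * g y - \<psi> k y * g x)\<^sup>2 * w x * w y) \<partial>lborel \<partial>lborel)" for k
  \<comment> \<open>The constant is kept under the integral, so that Fatou applies to the complete
    summand.\<close>
  define H where "H k = (\<integral>\<^sup>+x. (K * ennreal c) * ennreal ((\<psi> k x)\<^sup>2 * w x) \<partial>lborel)" for k
  have ineq': "L k + H k \<le> K * Q k" for k
    using ineq[of k] by (simp add: L_def H_def Q_def nn_integral_cmult mult.assoc)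
  have "?D = (\<integral>\<^sup>+x. \<integral>\<^sup>+y. ennreal ((u x * g y - u y * g x)\<^sup>2 * w x * w y) \<partial>lborel \<partial>lborel)"
    by (simp add: nn_integral_completion)
  also have "\<dots> \<le> liminf (\<lambda>k. L (r k))"
    unfolding L_def
  proof (rule nn_integral_pair_Fatou)
    show "AE x in lborel. AE y in lborel. (\<lambda>n. ennreal ((\<psi> (r n) x * g y - \<psi> (r n) y * g x)\<^sup>2 * w x * w y))
        \<longlonglongrightarrow> ennreal ((u x * g y - u y * g x)\<^sup>2 * w x * w y)"
      using ae
    proof eventually_elim
      case (elim x)
      note x = elim
      show ?case using ae
        by eventually_elim (intro tendsto_intros x)
    qed
  qed measurable
  finally have D: "?D \<le> liminf (\<lambda>k. L (r k))" .
  have "K * (ennreal c * ?G) = (\<integral>\<^sup>+x. (K * ennreal c) * ennreal ((u x)\<^sup>2 * w x) \<partial>lebesgue)"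
    by (simp add: nn_integral_cmult mult.assoc)
  also have "\<dots> = (\<integral>\<^sup>+x. (K * ennreal c) * ennreal ((u x)\<^sup>2 * w x) \<partial>lborel)"
    by (simp add: nn_integral_completion)
  also have "\<dots> = (\<integral>\<^sup>+x. liminf (\<lambda>k. (K * ennreal c) * ennreal ((\<psi> (r k) x)\<^sup>2 * w x)) \<partial>lborel)"
  proof (rule nn_integral_cong_AE, use ae in eventually_elim)
    fix x assume "(\<lambda>k. \<psi> (r k) x) \<longlonglongrightarrow> u x"
    then have "(\<lambda>k. (K * ennreal c) * ennreal ((\<psi> (r k) x)\<^sup>2 * w x)) \<longlonglongrightarrow> (K * ennreal c) * ennreal ((u x)\<^sup>2 * w x)"
      using K by (intro ennreal_tendsto_cmult tendsto_intros) (auto simp: ennreal_mult_less_top)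
    then show "(K * ennreal c) * ennreal ((u x)\<^sup>2 * w x) = liminf (\<lambda>k. (K * ennreal c) * ennreal ((\<psi> (r k) x)\<^sup>2 * w x))"
      by (simp add: lim_imp_Liminf)
  qed
  also have "\<dots> \<le> liminf (\<lambda>k. H (r k))"
    unfolding H_def by (rule nn_integral_liminf) measurable
  finally have "?D + K * (ennreal c * ?G) \<le> liminf (\<lambda>k. L (r k)) + liminf (\<lambda>k. H (r k))"
    using D by (intro add_mono)
  also have "\<dots> \<le> liminf (\<lambda>k. L (r k) + H (r k))"
    by (rule liminf_add_ennreal)
  finally have low: "?D + K * (ennreal c * ?G) \<le> liminf (\<lambda>k. L (r k) + H (r k))" .
  \<comment> \<open>For fixed \<epsilon> the error integrals \<open>a\<close> and \<open>b\<close>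
    tend to 0 despite the large factor 1 + 1 / \<epsilon>. Finiteness of \<open>K\<close> makes
    multiplication by it continuous in \<open>ennreal\<close>.\<close>
  have step: "?D + K * (ennreal c * ?G) \<le> K * (ennreal (1 + \<epsilon>) * (?B + ennreal d * ?A))" if e: "\<epsilon> > 0" for \<epsilon>
  proof -
    define X where "X k = (ennreal (1 + \<epsilon>) * ?B + ennreal (1 + 1 / \<epsilon>) * b k) + ennreal d * (ennreal (1 + \<epsilon>) * ?A + ennreal (1 + 1 / \<epsilon>) * a k)" for k
    have "Q k \<le> X k" for k
    proof -
      have "(\<integral>\<^sup>+x. ennreal ((norm (D\<psi> k x))\<^sup>2 * wB x) \<partial>lebesgue) \<le> ennreal (1 + \<epsilon>) * ?B + ennreal (1 + 1 / \<epsilon>) * b k"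
        unfolding b_def by (rule nn_integral_weighted_square_perturb[OF _ _ _ w(3) e]) measurable
      moreover have "(\<integral>\<^sup>+x. ennreal ((\<psi> k x)\<^sup>2 * wA x) \<partial>lebesgue) \<le> ennreal (1 + \<epsilon>) * ?A + ennreal (1 + 1 / \<epsilon>) * a k"
        using nn_integral_weighted_square_perturb[of u lebesgue "\<psi> k" wA, OF _ _ _ w(2) e] unfolding a_def by simp
      ultimately show ?thesis
        unfolding Q_def X_def by (intro add_mono mult_left_mono) (auto simp: nn_integral_completion)
    qed
    then have "L (r k) + H (r k) \<le> K * X (r k)" for k
      using ineq'[of "r k"] by (meson mult_left_mono order_trans zero_le)
    then have "liminf (\<lambda>k. L (r k) + H (r k)) \<le> liminf (\<lambda>k. K * X (r k))"
      by (intro Liminf_mono always_eventually) auto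
    also have "(\<lambda>k. K * X (r k)) \<longlonglongrightarrow> K * ((ennreal (1 + \<epsilon>) * ?B + ennreal (1 + 1 / \<epsilon>) * 0) + ennreal d * (ennreal (1 + \<epsilon>) * ?A + ennreal (1 + 1 / \<epsilon>) * 0))"
      unfolding X_def
      using LIMSEQ_subseq_LIMSEQ[OF alim r] LIMSEQ_subseq_LIMSEQ[OF blim r] K
      by (intro ennreal_tendsto_cmult tendsto_add tendsto_const) (auto simp: o_def)
    then have "liminf (\<lambda>k. K * X (r k)) = K * (ennreal (1 + \<epsilon>) * (?B + ennreal d * ?A))"
      by (subst lim_imp_Liminf) (auto simp: distrib_left mult.left_commute)
    finally show ?thesis using low by (rule order_trans[rotated])
  qed
  \<comment> \<open>Now \<epsilon> tends to 0 through 1 / (n + 1); the limit passes through the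
    product because the energy of \<open>u\<close> is finite by \<open>fin\<close>.\<close>
  have "(\<lambda>n. K * (ennreal (1 + 1 / (real n + 1)) * (?B + ennreal d * ?A))) \<longlonglongrightarrow> K * (ennreal (1 + 0) * (?B + ennreal d * ?A))"
  proof (intro ennreal_tendsto_cmult K)
    have "?B + ennreal d * ?A < top"
      using fin by (auto simp: ennreal_mult_less_top)
    moreover have "(\<lambda>n. ennreal (1 + 1 / (real n + 1))) \<longlonglongrightarrow> ennreal (1 + 0)"
      using LIMSEQ_inverse_real_of_nat
      by (intro tendsto_ennrealI tendsto_add tendsto_const) (simp add: inverse_eq_divide add.commute)
    ultimately show "(\<lambda>n. ennreal (1 + 1 / (real n + 1)) * (?B + ennreal d * ?A)) \<longlonglongrightarrow> ennreal (1 + 0) * (?B + ennreal d * ?A)"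
      by (subst (1 2) mult.commute, intro ennreal_tendsto_cmult)
  qed
  then have "?D + K * (ennreal c * ?G) \<le> K * (ennreal (1 + 0) * (?B + ennreal d * ?A))"
    by (rule LIMSEQ_le_const) (use step in \<open>auto intro!: exI[of _ 0]\<close>)
  then show ?thesis by simp
qed

section \<open>Test functions, Gaussian constants and the estimate on \<open>X_space\<close>\<close>

lemma gradient_inner:
  assumes "f differentiable (at x)"
  shows "gradient f x \<bullet> h = frechet_derivative f (at x) h"
proof -
  have lin: "linear (frechet_derivative f (at x))"
    by (rule linear_frechet_derivative[OF assms])
  have "gradient f x \<bullet> h = (\<Sum>i\<in>UNIV. h $ i * frechet_derivative f (at x) (axis i 1))"
    by (simp add: gradient_def partial_deriv_def inner_vec_def mult.commute)
  also have "\<dots> = frechet_derivative f (at x) (\<Sum>i\<in>UNIV. h $ i *\<^sub>R axis i 1)"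
    by (simp add: linear_sum[OF lin] linear_scale[OF lin])
  also have "(\<Sum>i\<in>UNIV. h $ i *\<^sub>R axis i 1) = h"
    using basis_expansion[of h] by (simp add: scalar_mult_eq_scaleR)
  finally show ?thesis .
qed

lemma test_function_C1:
  fixes \<phi> :: "real ^ 'n::finite \<Rightarrow> real"
  assumes "\<phi> \<in> test_functions"
  shows "\<And>x. (\<phi> has_derivative (\<lambda>h. gradient \<phi> x \<bullet> h)) (at x)"
    and "continuous_on UNIV (gradient \<phi>)"
    and "\<exists>R. \<forall>x. norm x > R \<longrightarrow> \<phi> x = 0"
proof -
  have "C_k (Suc 0) \<phi>" and c: "compact (closure {x. \<phi> x \<noteq> 0})"
    using assms by (auto simp: test_functions_def simp del: C_k.simps)
  then have d: "\<And>x. \<phi> differentiable (at x)" and p: "\<And>i. continuous_on UNIV (partial_deriv i \<phi>)"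
    by auto
  show "(\<phi> has_derivative (\<lambda>h. gradient \<phi> x \<bullet> h)) (at x)" for x
    unfolding gradient_inner[OF d] using d frechet_derivative_works by blast
  show "continuous_on UNIV (gradient \<phi>)"
    unfolding gradient_def[abs_def] by (intro continuous_on_vec_lambda p)
  obtain R where R: "\<And>x. x \<in> closure {x. \<phi> x \<noteq> 0} \<Longrightarrow> norm x \<le> R"
    using compact_imp_bounded[OF c] by (auto simp: bounded_iff)
  have "\<phi> x = 0" if "norm x > R" for x
    using R[of x] that closure_subset[of "{x. \<phi> x \<noteq> 0}"] by (force simp: not_le[symmetric])
  then show "\<exists>R. \<forall>x. norm x > R \<longrightarrow> \<phi> x = 0"
    by blast
qed

lemma nn_integral_lborel_pos:
  fixes f :: "'a::euclidean_space \<Rightarrow> ennreal"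
  assumes [measurable]: "f \<in> borel_measurable borel" and "\<And>x. x \<noteq> 0 \<Longrightarrow> f x > 0"
  shows "(\<integral>\<^sup>+x. f x \<partial>lborel) > 0"
proof (rule ccontr)
  assume "\<not> (\<integral>\<^sup>+x. f x \<partial>lborel) > 0"
  then have "AE x in lborel. f x = 0"
    by (simp add: nn_integral_0_iff_AE not_less)
  then have "AE x in (lborel :: 'a measure). False"
    using AE_lborel_singleton[of "0::'a"] by eventually_elim (use assms(2) in force)
  then have "emeasure (lborel :: 'a measure) UNIV = 0"
    by (simp add: AE_iff_measurable[of UNIV])
  then show False by (simp add: emeasure_lborel_UNIV)
qed

text \<open>Dilation by sqrt c shows that c times second moment over mass does not depend on c; the
  cross-multiplied form avoids division in \<open>ennreal\<close>. It makes the \<beta>-dependence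
  of the Poincare constant explicit.\<close>

lemma gaussian_moment_scaling:
  assumes c: "c > 0"
  shows "ennreal c * (\<integral>\<^sup>+(y::'a::euclidean_space). ennreal ((norm y)\<^sup>2 * exp (- c * (norm y)\<^sup>2)) \<partial>lborel)
       * (\<integral>\<^sup>+(y::'a). ennreal (exp (- (norm y)\<^sup>2)) \<partial>lborel)
    = (\<integral>\<^sup>+(y::'a). ennreal ((norm y)\<^sup>2 * exp (- (norm y)\<^sup>2)) \<partial>lborel)
       * (\<integral>\<^sup>+(y::'a). ennreal (exp (- c * (norm y)\<^sup>2)) \<partial>lborel)" (is "_ * ?Mc * ?Z1 = ?M1 * ?Zc")
proof -
  let ?s = "ennreal (\<bar>sqrt c\<bar> ^ DIM('a))"
  have n: "(norm (sqrt c *\<^sub>R y))\<^sup>2 = c * (norm y)\<^sup>2" for y :: 'a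
    using c by (simp add: power_mult_distrib)
  have Z: "?Z1 = ?s * ?Zc"
    using c by (subst nn_integral_lborel_dilation[of _ "sqrt c"]) (auto simp only: n, auto)
  have "?M1 = ?s * (\<integral>\<^sup>+(y::'a). ennreal (c * (norm y)\<^sup>2 * exp (- (c * (norm y)\<^sup>2))) \<partial>lborel)"
    using c by (subst nn_integral_lborel_dilation[of _ "sqrt c"]) (auto simp only: n, auto)
  also have "(\<integral>\<^sup>+(y::'a). ennreal (c * (norm y)\<^sup>2 * exp (- (c * (norm y)\<^sup>2))) \<partial>lborel)
      = (\<integral>\<^sup>+(y::'a). ennreal c * ennreal ((norm y)\<^sup>2 * exp (- c * (norm y)\<^sup>2)) \<partial>lborel)"
    using c by (simp add: mult.assoc flip: ennreal_mult)
  also have "\<dots> = ennreal c * ?Mc"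
    by (rule nn_integral_cmult) measurable
  finally have M: "?M1 = ?s * (ennreal c * ?Mc)" .
  show ?thesis unfolding Z M by (simp only: ac_simps)
qed

lemma X_space_weighted_stability:
  fixes u :: "real ^ 'n::finite \<Rightarrow> real" and Du :: "real ^ 'n \<Rightarrow> real ^ 'n" and \<kappa> \<beta> a b :: real
  assumes X: "(u, Du) \<in> X_space a b" and k: "\<kappa> \<ge> 1" and be: "\<beta> > 0" and N2: "CARD('n) \<ge> 2"
  defines "N \<equiv> real CARD('n)"
  assumes b: "- (2 * b) = (N - 2) * (1 / \<kappa> - 1)" and a: "- (2 * a) = (N + 2) * (1 / \<kappa> - 1) + 2"
  defines "g \<equiv> \<lambda>x::real ^ 'n. exp (- (\<beta> * \<kappa> / 2) * norm x powr (2 / \<kappa>))"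
    and "w \<equiv> \<lambda>x::real ^ 'n. norm x powr (N / \<kappa> - N)"
    and "K \<equiv> ennreal (\<kappa> ^ 3 * pi\<^sup>2 / 4) * (\<integral>\<^sup>+(y::real ^ 'n). ennreal ((norm y)\<^sup>2 * exp (- (\<beta> * \<kappa>) * (norm y)\<^sup>2)) \<partial>lborel)"
  shows "(\<integral>\<^sup>+x. \<integral>\<^sup>+y. ennreal ((u x * g y - u y * g x)\<^sup>2 * w x * w y) \<partial>lebesgue \<partial>lebesgue)
        + K * (ennreal (\<beta> * N / \<kappa>) * (\<integral>\<^sup>+x. ennreal ((u x)\<^sup>2 * w x) \<partial>lebesgue))
      \<le> K * ((\<integral>\<^sup>+x. ennreal ((norm (Du x))\<^sup>2 * norm x powr - (2 * b)) \<partial>lebesgue)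
         + ennreal (\<beta>\<^sup>2) * (\<integral>\<^sup>+x. ennreal (\<bar>u x\<bar>\<^sup>2 * norm x powr - (2 * a)) \<partial>lebesgue))"
proof -
  \<comment> \<open>Dividing by a power and multiplying by its inverse agree even at the origin,
    where both give 0.\<close>
  have XN: "X_norm_sq a b v Dv = (\<integral>\<^sup>+x. ennreal ((norm (Dv x))\<^sup>2 * norm x powr - (2 * b)) \<partial>lebesgue)
     + (\<integral>\<^sup>+x. ennreal (\<bar>v x\<bar>\<^sup>2 * norm x powr - (2 * a)) \<partial>lebesgue)" for v :: "real ^ 'n \<Rightarrow> real" and Dv :: "real ^ 'n \<Rightarrow> real ^ 'n"
    by (simp add: X_norm_sq_def powr_minus divide_inverse)
  obtain \<phi> where u: "u \<in> borel_measurable lebesgue" "Du \<in> borel_measurable lebesgue"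
    and fin: "X_norm_sq a b u Du < \<infinity>" and \<phi>: "\<And>k. \<phi> k \<in> test_functions"
    and lim: "(\<lambda>k. X_norm_sq a b (\<lambda>x. u x - \<phi> k x) (\<lambda>x. Du x - gradient (\<phi> k) x)) \<longlonglongrightarrow> 0"
    using X unfolding X_space_def by blast
  note C1 = test_function_C1[OF \<phi>]
  have Kt: "K < top"
  proof -
    have "(\<integral>\<^sup>+(y::real ^ 'n). ennreal ((norm y)\<^sup>2 * exp (- (\<beta> * \<kappa>) * (norm y)\<^sup>2)) \<partial>lborel)
       \<le> (\<integral>\<^sup>+(y::real ^ 'n). ennreal ((1 + (norm y)\<^sup>2) * exp (- (\<beta> * \<kappa>) * (norm y)\<^sup>2)) \<partial>lborel)"
      by (intro nn_integral_mono ennreal_leI mult_right_mono) auto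
    also have "\<dots> < \<infinity>"
      using k be by (intro nn_integral_gaussian_moment) simp
    finally show ?thesis
      by (simp add: K_def ennreal_mult_less_top)
  qed
  show ?thesis
  proof (rule weighted_stability_closure[OF u, where \<psi>=\<phi> and D\<psi>="\<lambda>k. gradient (\<phi> k)"])
    show "\<phi> k \<in> borel_measurable borel" for k
      using C1(1)[of k] by (intro borel_measurable_continuous_onI) (meson continuous_at_imp_continuous_on has_derivative_continuous)
    show "gradient (\<phi> k) \<in> borel_measurable borel" for k
      by (intro borel_measurable_continuous_onI C1)
    show "AE x in lborel. 0 < norm (x::real ^ 'n) powr - (2 * a)"
      using AE_lborel_singleton[of "0::real ^ 'n"] by eventually_elim simp
    show "(\<integral>\<^sup>+x. \<integral>\<^sup>+y. ennreal ((\<phi> k x * g y - \<phi> k y * g x)\<^sup>2 * w x * w y) \<partial>lborel \<partial>lborel)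
        + K * (ennreal (\<beta> * N / \<kappa>) * (\<integral>\<^sup>+x. ennreal ((\<phi> k x)\<^sup>2 * w x) \<partial>lborel))
      \<le> K * ((\<integral>\<^sup>+x. ennreal ((norm (gradient (\<phi> k) x))\<^sup>2 * norm x powr - (2 * b)) \<partial>lborel)
        + ennreal (\<beta>\<^sup>2) * (\<integral>\<^sup>+x. ennreal ((\<phi> k x)\<^sup>2 * norm x powr - (2 * a)) \<partial>lborel))" for k
    proof -
      obtain R where "\<And>x. norm x > R \<Longrightarrow> \<phi> k x = 0" using C1(3)[of k] by blast
      from weighted_stability_smooth[OF C1(1) C1(2) this k less_imp_le[OF be]] N2
      show ?thesis unfolding a b K_def g_def w_def N_def by simp
    qed
    show "(\<lambda>k. (\<integral>\<^sup>+x. ennreal ((norm (Du x - gradient (\<phi> k) x))\<^sup>2 * norm x powr - (2 * b)) \<partial>lebesgue)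
         + (\<integral>\<^sup>+x. ennreal (\<bar>u x - \<phi> k x\<bar>\<^sup>2 * norm x powr - (2 * a)) \<partial>lebesgue)) \<longlonglongrightarrow> 0"
      using lim unfolding XN .
    show "(\<integral>\<^sup>+x. ennreal ((norm (Du x))\<^sup>2 * norm x powr - (2 * b)) \<partial>lebesgue)
         + (\<integral>\<^sup>+x. ennreal (\<bar>u x\<bar>\<^sup>2 * norm x powr - (2 * a)) \<partial>lebesgue) < \<infinity>"
      using fin unfolding XN .
  qed (auto simp: g_def w_def Kt)
qed

lemma nn_integral_cross_difference:
  fixes u g w :: "'a \<Rightarrow> real"
  assumes [measurable]: "u \<in> borel_measurable M" "g \<in> borel_measurable M" "w \<in> borel_measurable M"
    and w: "\<And>x. w x \<ge> 0"
    and iu: "integrable M (\<lambda>x. (u x)\<^sup>2 * w x)" and ig: "integrable M (\<lambda>x. (g x)\<^sup>2 * w x)"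
  shows "integrable M (\<lambda>x. u x * g x * w x)"
    and "(\<integral>\<^sup>+x. \<integral>\<^sup>+y. ennreal ((u x * g y - u y * g x)\<^sup>2 * w x * w y) \<partial>M \<partial>M) =
      ennreal (2 * ((\<integral>x. (u x)\<^sup>2 * w x \<partial>M) * (\<integral>x. (g x)\<^sup>2 * w x \<partial>M) - (\<integral>x. u x * g x * w x \<partial>M)\<^sup>2))"
    and "(\<integral>x. u x * g x * w x \<partial>M)\<^sup>2 \<le> (\<integral>x. (u x)\<^sup>2 * w x \<partial>M) * (\<integral>x. (g x)\<^sup>2 * w x \<partial>M)"
proof -
  show ii: "integrable M (\<lambda>x. u x * g x * w x)"
  proof (rule Bochner_Integration.integrable_bound)
    show "integrable M (\<lambda>x. (u x)\<^sup>2 * w x + (g x)\<^sup>2 * w x)" using iu ig by simp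
    have "\<bar>p * q\<bar> \<le> p\<^sup>2 + q\<^sup>2" for p q :: real
    proof -
      have "0 \<le> (\<bar>p\<bar> - \<bar>q\<bar>)\<^sup>2" by simp
      then have "2 * (\<bar>p\<bar> * \<bar>q\<bar>) \<le> p\<^sup>2 + q\<^sup>2" by (simp add: power2_diff)
      moreover have "0 \<le> \<bar>p\<bar> * \<bar>q\<bar>" by simp
      ultimately show ?thesis unfolding abs_mult by linarith
    qed
    from mult_right_mono[OF this w]
    show "AE x in M. norm (u x * g x * w x) \<le> norm ((u x)\<^sup>2 * w x + (g x)\<^sup>2 * w x)"
      using w by (intro AE_I2) (simp add: abs_mult[of _ "w _"] distrib_right[symmetric])
  qed measurable
  define G Z I where "G = (\<integral>x. (u x)\<^sup>2 * w x \<partial>M)" and "Z = (\<integral>x. (g x)\<^sup>2 * w x \<partial>M)" and "I = (\<integral>x. u x * g x * w x \<partial>M)"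
  define F where "F x = (u x)\<^sup>2 * w x * Z - 2 * I * (u x * g x * w x) + (g x)\<^sup>2 * w x * G" for x
  have inner: "(\<integral>\<^sup>+y. ennreal ((u x * g y - u y * g x)\<^sup>2 * w x * w y) \<partial>M) = ennreal (F x)" and Fnn: "F x \<ge> 0" for x
  proof -
    let ?f = "\<lambda>y. (u x)\<^sup>2 * w x * ((g y)\<^sup>2 * w y) - 2 * (u x * g x * w x) * (u y * g y * w y) + (g x)\<^sup>2 * w x * ((u y)\<^sup>2 * w y)"
    have eq: "(u x * g y - u y * g x)\<^sup>2 * w x * w y = ?f y" for y
      by (simp add: power2_eq_square algebra_simps)
    have int: "integrable M ?f"
      using iu ig ii by simp
    have nn: "?f y \<ge> 0" for y
      unfolding eq[symmetric] using w by simp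
    have "(\<integral>y. ?f y \<partial>M) = F x"
      using iu ig ii by (simp add: F_def G_def Z_def I_def)
    moreover have "(\<integral>y. ?f y \<partial>M) \<ge> 0"
      by (rule integral_nonneg_AE) (use nn in simp)
    ultimately show "(\<integral>\<^sup>+y. ennreal ((u x * g y - u y * g x)\<^sup>2 * w x * w y) \<partial>M) = ennreal (F x)" "F x \<ge> 0"
      unfolding eq using nn_integral_eq_integral[OF int] nn by auto
  qed
  have F1: "integrable M F"
    unfolding F_def using iu ig ii by simp
  have "(\<integral>x. F x \<partial>M) = G * Z - 2 * I * I + Z * G"
    unfolding F_def using iu ig ii by (simp add: G_def[symmetric] Z_def[symmetric] I_def[symmetric])
  then have F2: "(\<integral>x. F x \<partial>M) = 2 * (G * Z - I\<^sup>2)"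
    by (simp add: power2_eq_square)
  have "(\<integral>\<^sup>+x. ennreal (F x) \<partial>M) = ennreal (2 * (G * Z - I\<^sup>2))"
    using nn_integral_eq_integral[OF F1] Fnn F2 by simp
  then show "(\<integral>\<^sup>+x. \<integral>\<^sup>+y. ennreal ((u x * g y - u y * g x)\<^sup>2 * w x * w y) \<partial>M \<partial>M) = ennreal (2 * (G * Z - I\<^sup>2))"
    unfolding inner .
  have "0 \<le> 2 * (G * Z - I\<^sup>2)"
    unfolding F2[symmetric] using Fnn by (intro integral_nonneg_AE) simp
  then show "I\<^sup>2 \<le> G * Z" by simp
qed

section \<open>The deficit and the stability estimate\<close>

lemma nn_integral_weighted_profile:
  fixes \<beta> \<kappa> :: real
  assumes k: "\<kappa> > 0"
  shows "(\<integral>\<^sup>+(x::'a::euclidean_space). ennreal ((exp (- (\<beta> * \<kappa> / 2) * norm x powr (2 / \<kappa>)))\<^sup>2 * norm x powr (DIM('a) / \<kappa> - DIM('a))) \<partial>lborel)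
    = ennreal \<kappa> * (\<integral>\<^sup>+(y::'a). ennreal (exp (- (\<beta> * \<kappa>) * (norm y)\<^sup>2)) \<partial>lborel)"
proof -
  let ?h = "\<lambda>x::'a. ennreal ((exp (- (\<beta> * \<kappa> / 2) * norm x powr (2 / \<kappa>)))\<^sup>2)"
  have "(\<integral>\<^sup>+(x::'a). ennreal ((exp (- (\<beta> * \<kappa> / 2) * norm x powr (2 / \<kappa>)))\<^sup>2 * norm x powr (DIM('a) / \<kappa> - DIM('a))) \<partial>lborel)
      = (\<integral>\<^sup>+x. ?h x * ennreal (norm x powr (DIM('a) / \<kappa> - DIM('a))) \<partial>lborel)"
    by (simp add: ennreal_mult)
  also have "\<dots> = ennreal \<kappa> * (\<integral>\<^sup>+y. ?h (norm y powr (\<kappa> - 1) *\<^sub>R y) \<partial>lborel)"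
    by (rule nn_integral_radial_substitution[OF _ k]) measurable
  also have "(\<integral>\<^sup>+y. ?h (norm y powr (\<kappa> - 1) *\<^sub>R y) \<partial>lborel) = (\<integral>\<^sup>+(y::'a). ennreal (exp (- (\<beta> * \<kappa>) * (norm y)\<^sup>2)) \<partial>lborel)"
    unfolding norm_radial_power using k
    by (intro nn_integral_cong arg_cong[where f=ennreal])
       (simp add: powr_powr power2_eq_square[of "exp _"] exp_add[symmetric])
  finally show ?thesis .
qed

text \<open>The left-hand side of the estimate is the squared distance of \<open>u\<close> to the
  line spanned by \<open>g \<beta>\<close>. The point of the quantifier order is that
  \<open>P\<close> serves all \<beta> at once, so \<beta> may later be adapted to
  \<open>u\<close>.\<close>

lemma X_space_deficit:
  fixes a b N :: real
  assumes N: "N = real CARD('n::finite)" and b: "0 \<le> b" "b < (N - 2) / 2"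
    and ab: "a + b + 1 = 2 * b * N / (N - 2)"
  defines "w \<equiv> \<lambda>x::real ^ 'n. norm x powr - (a + b + 1)"
    and "g \<equiv> \<lambda>\<beta> x::real ^ 'n. extremal a b 1 \<beta> x"
  shows "\<exists>P>0. \<forall>(u :: real ^ 'n \<Rightarrow> real) Du \<beta>. (u, Du) \<in> X_space a b \<longrightarrow> \<beta> > 0 \<longrightarrow>
     integrable lebesgue (\<lambda>x. (u x)\<^sup>2 * w x) \<and> integrable lebesgue (\<lambda>x. (g \<beta> x)\<^sup>2 * w x) \<and>
     (\<integral>x. (g \<beta> x)\<^sup>2 * w x \<partial>lebesgue) > 0 \<and>
     (\<integral>x. (u x)\<^sup>2 * w x \<partial>lebesgue) - (\<integral>x. u x * g \<beta> x * w x \<partial>lebesgue)\<^sup>2 / (\<integral>x. (g \<beta> x)\<^sup>2 * w x \<partial>lebesgue)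
     \<le> P * ((\<integral>x. (norm (Du x))\<^sup>2 / norm x powr (2 * b) \<partial>lebesgue) / \<beta>
        + \<beta> * (\<integral>x. \<bar>u x\<bar>\<^sup>2 / norm x powr (2 * a) \<partial>lebesgue)
        - (N - a - b - 1) * (\<integral>x. (u x)\<^sup>2 * w x \<partial>lebesgue))"
proof -
  \<comment> \<open>The single parameter behind all weights: 2 b = (N - 2) t and a + b + 1 = N t,
    with 0 \<le> t < 1.\<close>
  define t where "t = 2 * b / (N - 2)"
  define \<kappa> where "\<kappa> = 1 / (1 - t)"
  have N2: "N - 2 > 0" using b by simp
  then have t: "0 \<le> t" "t < 1" using b by (auto simp: t_def field_simps)
  have bt: "2 * b = (N - 2) * t" and abt: "a + b + 1 = N * t"
    using N2 ab by (auto simp: t_def)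
  have k: "\<kappa> \<ge> 1" and ik: "1 / \<kappa> = 1 - t" using t by (auto simp: \<kappa>_def)
  have k0: "\<kappa> > 0" using k by simp
  have card: "CARD('n) \<ge> 2" using N2 N by simp
  have eb: "- (2 * b) = (N - 2) * (1 / \<kappa> - 1)" unfolding ik bt by simp
  have ea: "- (2 * a) = (N + 2) * (1 / \<kappa> - 1) + 2"
    using bt abt unfolding ik by (simp add: algebra_simps)
  have ikc: "x / \<kappa> = x - x * t" for x
  proof -
    have "x / \<kappa> = x * (1 / \<kappa>)" by simp
    also have "\<dots> = x - x * t" unfolding ik by (simp add: right_diff_distrib)
    finally show ?thesis .
  qed
  note ik2 = ikc[of 2] and ikN = ikc[of N]
  have ikN': "N / \<kappa> - N = - (a + b + 1)"
    using ikN abt by simp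
  have s: "b + 1 - a = 2 / \<kappa>"
    using bt abt ik2 by (simp add: algebra_simps)
  have gk: "g \<beta> x = exp (- (\<beta> * \<kappa> / 2) * norm x powr (2 / \<kappa>))" for \<beta> x
    unfolding g_def extremal_def s by simp
  have wk: "w x = norm x powr (N / \<kappa> - N)" for x
    unfolding w_def ikN' ..
  define M where "M c = (\<integral>\<^sup>+(y::real ^ 'n). ennreal ((norm y)\<^sup>2 * exp (- c * (norm y)\<^sup>2)) \<partial>lborel)" for c :: real
  define Z where "Z c = (\<integral>\<^sup>+(y::real ^ 'n). ennreal (exp (- c * (norm y)\<^sup>2)) \<partial>lborel)" for c :: real
  have fin: "M c < \<infinity>" "Z c < \<infinity>" if c: "c > 0" for c
  proof -
    have "M c \<le> (\<integral>\<^sup>+(y::real ^ 'n). ennreal ((1 + (norm y)\<^sup>2) * exp (- c * (norm y)\<^sup>2)) \<partial>lborel)"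
      unfolding M_def by (intro nn_integral_mono ennreal_leI mult_right_mono) auto
    then show "M c < \<infinity>" using nn_integral_gaussian_moment[OF c, where 'a="real ^ 'n"] by (rule order_le_less_trans)
    have "Z c \<le> (\<integral>\<^sup>+(y::real ^ 'n). ennreal ((1 + (norm y)\<^sup>2) * exp (- c * (norm y)\<^sup>2)) \<partial>lborel)"
      unfolding Z_def by (intro nn_integral_mono ennreal_leI) (simp add: distrib_right)
    then show "Z c < \<infinity>" using nn_integral_gaussian_moment[OF c, where 'a="real ^ 'n"] by (rule order_le_less_trans)
  qed
  have pos: "M c > 0" "Z c > 0" for c
    unfolding M_def Z_def by (rule nn_integral_lborel_pos; simp)+
  define m z where "m c = enn2real (M c)" and "z c = enn2real (Z c)" for c
  have mz: "m c > 0" "z c > 0" "M c = ennreal (m c)" "Z c = ennreal (z c)" if "c > 0" for c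
    using fin[OF that] pos[of c] by (auto simp: m_def z_def enn2real_positive_iff less_top)
  have scal: "c * m c * z 1 = m 1 * z c" if c: "c > 0" for c
  proof -
    have "ennreal c * M c * Z 1 = M 1 * Z c"
      using gaussian_moment_scaling[OF c, where 'a="real ^ 'n"] unfolding M_def Z_def by simp
    then show ?thesis
      using c mz[OF c] mz[of 1] by (simp add: ennreal_mult[symmetric])
  qed
  \<comment> \<open>Chosen so that K / (2 Y) = P / \<beta>: here Y = \<kappa> z(c) with c = \<beta>
    \<kappa>, and by scaling m(c) / z(c) = m(1) / (c z(1)).\<close>
  define P where "P = \<kappa> * pi\<^sup>2 * m 1 / (8 * z 1)"
  have "P > 0" using k0 mz[of 1] by (simp add: P_def)
  moreover have "integrable lebesgue (\<lambda>x. (u x)\<^sup>2 * w x) \<and> integrable lebesgue (\<lambda>x. (g \<beta> x)\<^sup>2 * w x) \<and>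
     (\<integral>x. (g \<beta> x)\<^sup>2 * w x \<partial>lebesgue) > 0 \<and>
     (\<integral>x. (u x)\<^sup>2 * w x \<partial>lebesgue) - (\<integral>x. u x * g \<beta> x * w x \<partial>lebesgue)\<^sup>2 / (\<integral>x. (g \<beta> x)\<^sup>2 * w x \<partial>lebesgue)
     \<le> P * ((\<integral>x. (norm (Du x))\<^sup>2 / norm x powr (2 * b) \<partial>lebesgue) / \<beta>
        + \<beta> * (\<integral>x. \<bar>u x\<bar>\<^sup>2 / norm x powr (2 * a) \<partial>lebesgue)
        - (N - a - b - 1) * (\<integral>x. (u x)\<^sup>2 * w x \<partial>lebesgue))"
    if X: "(u, Du) \<in> X_space a b" and be: "\<beta> > 0" for u :: "real ^ 'n \<Rightarrow> real" and Du \<beta>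
  proof -
    define A where "A = (\<integral>x. \<bar>u x\<bar>\<^sup>2 / norm x powr (2 * a) \<partial>lebesgue)"
    define B where "B = (\<integral>x. (norm (Du x))\<^sup>2 / norm x powr (2 * b) \<partial>lebesgue)"
    define G where "G = (\<integral>x. (u x)\<^sup>2 * w x \<partial>lebesgue)"
    define Y where "Y = (\<integral>x. (g \<beta> x)\<^sup>2 * w x \<partial>lebesgue)"
    define I where "I = (\<integral>x. u x * g \<beta> x * w x \<partial>lebesgue)"
    define c where "c = \<beta> * \<kappa>"
    define K where "K = \<kappa> ^ 3 * pi\<^sup>2 / 4 * m c"
    have c: "c > 0" using be k0 by (simp add: c_def)
    have K0: "K > 0" using k0 mz[OF c] by (simp add: K_def)
    have u [measurable]: "u \<in> borel_measurable lebesgue" "Du \<in> borel_measurable lebesgue"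
      and Xf: "X_norm_sq a b u Du < \<infinity>"
      using X unfolding X_space_def by auto
    have [measurable]: "g \<beta> \<in> borel_measurable lebesgue" "w \<in> borel_measurable lebesgue"
      unfolding gk[abs_def] w_def by (intro measurable_completion, simp)+
    have wnn: "w x \<ge> 0" for x by (simp add: w_def)
    have [measurable]: "(\<lambda>x::real ^ 'n. norm x powr r) \<in> borel_measurable lebesgue" for r
      by (intro measurable_completion) simp
    have An: "(\<integral>\<^sup>+x. ennreal (\<bar>u x\<bar>\<^sup>2 / norm x powr (2 * a)) \<partial>lebesgue) = ennreal A"
      unfolding A_def using Xf
      by (intro nn_integral_eq_integral integrableI_nonneg) (auto simp: X_norm_sq_def)
    have Bn: "(\<integral>\<^sup>+x. ennreal ((norm (Du x))\<^sup>2 / norm x powr (2 * b)) \<partial>lebesgue) = ennreal B"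
      unfolding B_def using Xf
      by (intro nn_integral_eq_integral integrableI_nonneg) (auto simp: X_norm_sq_def)
    have A0: "A \<ge> 0" and B0: "B \<ge> 0" unfolding A_def B_def by (auto intro!: integral_nonneg_AE)
    have main: "(\<integral>\<^sup>+x. \<integral>\<^sup>+y. ennreal ((u x * g \<beta> y - u y * g \<beta> x)\<^sup>2 * w x * w y) \<partial>lebesgue \<partial>lebesgue)
        + ennreal K * (ennreal (\<beta> * N / \<kappa>) * (\<integral>\<^sup>+x. ennreal ((u x)\<^sup>2 * w x) \<partial>lebesgue))
      \<le> ennreal K * (ennreal B + ennreal (\<beta>\<^sup>2) * ennreal A)"
    proof -
      have "ennreal K = ennreal (\<kappa> ^ 3 * pi\<^sup>2 / 4) * M c"
        unfolding K_def mz(3)[OF c] using k0 mz(1)[OF c] by (intro ennreal_mult) auto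
      moreover have "(\<integral>\<^sup>+x. ennreal ((norm (Du x))\<^sup>2 * norm x powr - (2 * b)) \<partial>lebesgue) = ennreal B"
        using Bn by (simp add: powr_minus divide_inverse)
      moreover have "(\<integral>\<^sup>+x. ennreal (\<bar>u x\<bar>\<^sup>2 * norm x powr - (2 * a)) \<partial>lebesgue) = ennreal A"
        using An by (simp add: powr_minus divide_inverse)
      ultimately show ?thesis
        using X_space_weighted_stability[OF X k be card eb[unfolded N] ea[unfolded N]]
        unfolding gk wk M_def c_def N by simp
    qed
    \<comment> \<open>Membership in \<open>X_space\<close> bounds only the integrals A and B.
      Finiteness of G is read off the stability inequality, where it occurs on the left with a
      positive coefficient.\<close>
    have "(\<integral>\<^sup>+x. ennreal ((u x)\<^sup>2 * w x) \<partial>lebesgue) < \<infinity>"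
    proof (rule ccontr)
      assume "\<not> ?thesis"
      then have "ennreal K * (ennreal (\<beta> * N / \<kappa>) * (\<integral>\<^sup>+x. ennreal ((u x)\<^sup>2 * w x) \<partial>lebesgue)) = top"
        using K0 be k0 N2 by (auto simp: ennreal_mult_eq_top_iff less_top[symmetric])
      with main have "ennreal K * (ennreal B + ennreal (\<beta>\<^sup>2) * ennreal A) = top"
        by (simp add: top_unique)
      then show False by (auto simp: ennreal_mult_eq_top_iff)
    qed
    then have iu: "integrable lebesgue (\<lambda>x. (u x)\<^sup>2 * w x)"
      using wnn by (intro integrableI_nonneg) auto
    have Gn: "(\<integral>\<^sup>+x. ennreal ((u x)\<^sup>2 * w x) \<partial>lebesgue) = ennreal G"
      unfolding G_def using wnn by (intro nn_integral_eq_integral iu) auto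
    have G0: "G \<ge> 0" unfolding G_def using wnn by (intro integral_nonneg_AE) auto
    have Yn: "(\<integral>\<^sup>+x. ennreal ((g \<beta> x)\<^sup>2 * w x) \<partial>lebesgue) = ennreal (\<kappa> * z c)"
    proof -
      have "(\<integral>\<^sup>+x. ennreal ((g \<beta> x)\<^sup>2 * w x) \<partial>lebesgue) = ennreal \<kappa> * Z c"
        unfolding nn_integral_completion gk wk Z_def c_def N
        using nn_integral_weighted_profile[OF k0, of \<beta>, where 'a="real ^ 'n"] by simp
      then show ?thesis using k0 mz[OF c] by (simp add: ennreal_mult)
    qed
    have ig: "integrable lebesgue (\<lambda>x. (g \<beta> x)\<^sup>2 * w x)"
      using wnn Yn by (intro integrableI_nonneg) auto
    have Y: "Y = \<kappa> * z c"
      unfolding Y_def using wnn Yn k0 mz[OF c] by (subst integral_eq_nn_integral) auto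
    then have Y0: "Y > 0" using k0 mz[OF c] by simp
    note cross = nn_integral_cross_difference[OF u(1) _ _ wnn iu ig, folded G_def Y_def I_def]
    have "ennreal (2 * (G * Y - I\<^sup>2)) + ennreal K * (ennreal (\<beta> * N / \<kappa>) * ennreal G) \<le> ennreal K * (ennreal B + ennreal (\<beta>\<^sup>2) * ennreal A)"
      using main unfolding Gn by (subst (asm) cross(2)) auto
    moreover have "2 * (G * Y - I\<^sup>2) \<ge> 0" using cross(3) by simp
    ultimately have "2 * (G * Y - I\<^sup>2) + K * (\<beta> * N / \<kappa> * G) \<le> K * (B + \<beta>\<^sup>2 * A)"
      using K0 be k0 N2 A0 B0 G0 by (simp flip: ennreal_mult ennreal_plus)
    then have le: "G * Y - I\<^sup>2 \<le> K / 2 * (B + \<beta>\<^sup>2 * A - \<beta> * (N / \<kappa>) * G)"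
      by (simp add: algebra_simps)
    \<comment> \<open>Proved after multiplication by \<open>c * z 1\<close>, which exposes the
      combination that \<open>scal\<close> rewrites.\<close>
    have KY: "K / 2 = Y * (P / \<beta>)"
    proof -
      have "K / 2 * (c * z 1) = \<kappa> ^ 3 * pi\<^sup>2 / 8 * (c * m c * z 1)"
        by (simp add: K_def)
      also have "\<dots> = Y * (P / \<beta>) * (c * z 1)"
        using mz[of 1] be k0 unfolding scal[OF c] Y P_def
        by (simp add: c_def field_simps power3_eq_cube power2_eq_square)
      finally have "K / 2 * (c * z 1) = Y * (P / \<beta>) * (c * z 1)" .
      moreover have "c * z 1 \<noteq> 0" using c mz(2)[of 1] by simp
      ultimately show ?thesis using mult_right_cancel by blast
    qed
    have "G - I\<^sup>2 / Y = (G * Y - I\<^sup>2) / Y"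
      using Y0 by (simp add: field_simps)
    also have "\<dots> \<le> Y * (P / \<beta>) * (B + \<beta>\<^sup>2 * A - \<beta> * (N / \<kappa>) * G) / Y"
      using le Y0 unfolding KY by (intro divide_right_mono) auto
    also have "\<dots> = P * (B / \<beta> + \<beta> * A - N / \<kappa> * G)"
      using Y0 be by (simp add: field_simps power2_eq_square)
    also have "N / \<kappa> = N - a - b - 1"
      using ikN abt by simp
    finally have "G - I\<^sup>2 / Y \<le> P * (B / \<beta> + \<beta> * A - (N - a - b - 1) * G)" .
    then show ?thesis
      using iu ig Y0 unfolding A_def B_def G_def Y_def I_def by blast
  qed
  ultimately show ?thesis by blast
qed

theorem theorem1p1:
  fixes a b N :: real
  assumes N: "N = real CARD('n::finite)"
    and b: "0 \<le> b" "b < (N - 2) / 2"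
    and a: "a \<le> N * b / (N - 2)"
    and ab: "a + b + 1 = 2 * b * N / (N - 2)"
  shows "\<exists>C>0. \<forall>(u :: real ^ 'n \<Rightarrow> real) Du. (u, Du) \<in> X_space a b \<longrightarrow>
    sqrt (LINT x|lebesgue. \<bar>u x\<bar>\<^sup>2 / norm x powr (2 * a)) *
    sqrt (LINT x|lebesgue. (norm (Du x))\<^sup>2 / norm x powr (2 * b))
    - \<bar>(N - a - b - 1) / 2\<bar> * (LINT x|lebesgue. \<bar>u x\<bar>\<^sup>2 / norm x powr (a + b + 1))
    \<ge> C * (INF (\<alpha>, \<beta>) \<in> {(\<alpha>, \<beta>). \<beta> > 0 \<and>
              (LINT x|lebesgue. \<bar>u x\<bar>\<^sup>2 / norm x powr (a + b + 1)) =
              (LINT (x :: real ^ 'n)|lebesgue. \<bar>extremal a b \<alpha> \<beta> x\<bar>\<^sup>2 / norm x powr (a + b + 1))}.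
            LINT x|lebesgue. \<bar>u x - extremal a b \<alpha> \<beta> x\<bar>\<^sup>2 / norm x powr (a + b + 1))"
proof -
  define w where "w x = norm x powr - (a + b + 1)" for x :: "real ^ 'n"
  define g where "g \<beta> x = extremal a b 1 \<beta> x" for \<beta> and x :: "real ^ 'n"
  have N2: "N - 2 > 0" using b by simp
  have Q: "N - a - b - 1 > 0"
  proof -
    have "2 * b * N / (N - 2) < N"
      using mult_strict_right_mono[of "2 * b" "N - 2" N] b N2 by (simp add: pos_divide_less_eq mult.commute)
    then show ?thesis using ab by simp
  qed
  have wn: "y / norm x powr (a + b + 1) = y * w x" for y and x :: "real ^ 'n"
    unfolding w_def powr_minus divide_inverse ..
  have ext: "extremal a b \<alpha> \<beta> x = \<alpha> * g \<beta> x" for \<alpha> \<beta> and x :: "real ^ 'n"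
    by (simp add: g_def extremal_def)
  have wnn: "w x \<ge> 0" for x by (simp add: w_def)
  obtain P where P: "P > 0" and deficit: "\<And>(u :: real ^ 'n \<Rightarrow> real) Du \<beta>. (u, Du) \<in> X_space a b \<Longrightarrow> \<beta> > 0 \<Longrightarrow>
     integrable lebesgue (\<lambda>x. (u x)\<^sup>2 * w x) \<and> integrable lebesgue (\<lambda>x. (g \<beta> x)\<^sup>2 * w x) \<and>
     (\<integral>x. (g \<beta> x)\<^sup>2 * w x \<partial>lebesgue) > 0 \<and>
     (\<integral>x. (u x)\<^sup>2 * w x \<partial>lebesgue) - (\<integral>x. u x * g \<beta> x * w x \<partial>lebesgue)\<^sup>2 / (\<integral>x. (g \<beta> x)\<^sup>2 * w x \<partial>lebesgue)
     \<le> P * ((\<integral>x. (norm (Du x))\<^sup>2 / norm x powr (2 * b) \<partial>lebesgue) / \<beta>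
        + \<beta> * (\<integral>x. \<bar>u x\<bar>\<^sup>2 / norm x powr (2 * a) \<partial>lebesgue)
        - (N - a - b - 1) * (\<integral>x. (u x)\<^sup>2 * w x \<partial>lebesgue))"
    using X_space_deficit[OF N b ab] unfolding w_def g_def by blast
  \<comment> \<open>The 4 is 2 times 2: at the optimal \<beta> the bracket in \<open>deficit\<close>
    is twice the left-hand side of the claim, and meeting the norm constraint costs another factor
    2.\<close>
  have "1 / (4 * P) * (INF (\<alpha>, \<beta>) \<in> {(\<alpha>, \<beta>). \<beta> > 0 \<and>
              (LINT x|lebesgue. \<bar>u x\<bar>\<^sup>2 / norm x powr (a + b + 1)) =
              (LINT (x :: real ^ 'n)|lebesgue. \<bar>extremal a b \<alpha> \<beta> x\<bar>\<^sup>2 / norm x powr (a + b + 1))}.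
            LINT x|lebesgue. \<bar>u x - extremal a b \<alpha> \<beta> x\<bar>\<^sup>2 / norm x powr (a + b + 1))
      \<le> sqrt (LINT x|lebesgue. \<bar>u x\<bar>\<^sup>2 / norm x powr (2 * a)) *
    sqrt (LINT x|lebesgue. (norm (Du x))\<^sup>2 / norm x powr (2 * b))
    - \<bar>(N - a - b - 1) / 2\<bar> * (LINT x|lebesgue. \<bar>u x\<bar>\<^sup>2 / norm x powr (a + b + 1))"
    if X: "(u, Du) \<in> X_space a b" for u :: "real ^ 'n \<Rightarrow> real" and Du
  proof -
    define A where "A = (\<integral>x. \<bar>u x\<bar>\<^sup>2 / norm x powr (2 * a) \<partial>lebesgue)"
    define B where "B = (\<integral>x. (norm (Du x))\<^sup>2 / norm x powr (2 * b) \<partial>lebesgue)"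
    define G where "G = (\<integral>x. (u x)\<^sup>2 * w x \<partial>lebesgue)"
    define Y where "Y \<beta> = (\<integral>x. (g \<beta> x)\<^sup>2 * w x \<partial>lebesgue)" for \<beta>
    define I where "I \<beta> = (\<integral>x. u x * g \<beta> x * w x \<partial>lebesgue)" for \<beta>
    define S where "S = {(\<alpha>, \<beta>). \<beta> > 0 \<and> G = (\<integral>x. \<bar>\<alpha> * g \<beta> x\<bar>\<^sup>2 * w x \<partial>lebesgue)}"
    define J where "J = (\<lambda>(\<alpha>, \<beta>). \<integral>x. \<bar>u x - \<alpha> * g \<beta> x\<bar>\<^sup>2 * w x \<partial>lebesgue)"
    have goal: "?thesis \<longleftrightarrow> 1 / (4 * P) * Inf (J ` S) \<le> sqrt A * sqrt B - (N - a - b - 1) / 2 * G"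
      using Q unfolding A_def B_def G_def S_def J_def wn ext by (simp add: power2_abs)
    have u [measurable]: "u \<in> borel_measurable lebesgue"
      using X unfolding X_space_def by auto
    have [measurable]: "g \<beta> \<in> borel_measurable lebesgue" "w \<in> borel_measurable lebesgue" for \<beta>
      unfolding g_def extremal_def w_def by (intro measurable_completion, simp)+
    have A0: "A \<ge> 0" and B0: "B \<ge> 0" and G0: "G \<ge> 0"
      unfolding A_def B_def G_def using wnn by (auto intro!: integral_nonneg_AE)
    have iu: "integrable lebesgue (\<lambda>x. (u x)\<^sup>2 * w x)"
      using deficit[OF X, of 1] by simp
    have ig: "integrable lebesgue (\<lambda>x. (g \<beta> x)\<^sup>2 * w x)" and Y0: "Y \<beta> > 0"
      and le: "G - (I \<beta>)\<^sup>2 / Y \<beta> \<le> P * (B / \<beta> + \<beta> * A - (N - a - b - 1) * G)" if "\<beta> > 0" for \<beta>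
      using deficit[OF X that] unfolding A_def B_def G_def Y_def I_def by auto
    have cross: "integrable lebesgue (\<lambda>x. u x * g \<beta> x * w x)" "(I \<beta>)\<^sup>2 \<le> G * Y \<beta>" if "\<beta> > 0" for \<beta>
      using nn_integral_cross_difference(1,3)[OF u _ _ wnn iu ig[OF that]] unfolding G_def I_def Y_def by auto
    have J: "J (\<alpha>, \<beta>) = G - 2 * \<alpha> * I \<beta> + \<alpha>\<^sup>2 * Y \<beta>" if be: "\<beta> > 0" for \<alpha> \<beta>
    proof -
      have "J (\<alpha>, \<beta>) = (\<integral>x. (u x)\<^sup>2 * w x - 2 * \<alpha> * (u x * g \<beta> x * w x) + \<alpha>\<^sup>2 * ((g \<beta> x)\<^sup>2 * w x) \<partial>lebesgue)"
        unfolding J_def prod.case by (intro Bochner_Integration.integral_cong) (auto simp: power2_eq_square algebra_simps)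
      then show ?thesis
        using iu ig[OF be] cross(1)[OF be] by (simp add: G_def I_def Y_def)
    qed
    have mem: "(\<alpha>, \<beta>) \<in> S" if "\<beta> > 0" "G = \<alpha>\<^sup>2 * Y \<beta>" for \<alpha> \<beta>
      using that unfolding S_def Y_def by (simp add: power_mult_distrib mult.assoc)
    \<comment> \<open>For a real infimum this needs boundedness from below, which holds as all
      distances are nonnegative.\<close>
    have lower: "Inf (J ` S) \<le> J s" if "s \<in> S" for s
    proof (rule cINF_lower[OF _ that])
      show "bdd_below (J ` S)"
        using wnn by (intro bdd_belowI[of _ 0]) (auto simp: J_def intro!: integral_nonneg_AE)
    qed
    \<comment> \<open>Cauchy-Schwarz makes the left-hand side of \<open>le\<close> nonnegative,
      which leaves the inequality without remainder for every \<beta>; it settles the degenerate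
      case.\<close>
    have basic: "(N - a - b - 1) * G \<le> B / \<beta> + \<beta> * A" if be: "\<beta> > 0" for \<beta>
    proof -
      have "0 \<le> G - (I \<beta>)\<^sup>2 / Y \<beta>"
        using cross(2)[OF be] Y0[OF be] by (simp add: field_simps)
      with le[OF be] have "0 \<le> P * (B / \<beta> + \<beta> * A - (N - a - b - 1) * G)"
        by linarith
      then show ?thesis using P by (simp add: zero_le_mult_iff)
    qed
    have "1 / (4 * P) * Inf (J ` S) \<le> sqrt A * sqrt B - (N - a - b - 1) / 2 * G"
    proof (cases "A = 0 \<or> B = 0")
      case True
      \<comment> \<open>Here sqrt (B / A) is not an admissible \<beta>. If A = 0, a large \<beta>
        makes B / \<beta> smaller than any positive q; if B = 0, a small \<beta> does the same to
        \<beta> A. Hence G = 0, and the zero multiple of an extremal satisfies the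
        constraint.\<close>
      define q where "q = (N - a - b - 1) * G"
      have "q \<le> 0"
      proof (rule ccontr)
        assume "\<not> q \<le> 0"
        then have q: "q > 0" by simp
        show False
        proof (cases "A = 0")
          case True
          have "q \<le> B / ((B + 1) / q)"
            using basic[of "(B + 1) / q"] q B0 True by (simp add: q_def)
          then show False using q B0 by (simp add: field_simps)
        next
          case False
          then have "B = 0" using \<open>A = 0 \<or> B = 0\<close> by simp
          then have "q \<le> q / (A + 1) * A"
            using basic[of "q / (A + 1)"] q A0 by (simp add: q_def)
          then show False using q A0 by (simp add: field_simps)
        qed
      qed
      then have "G = 0" using Q G0 by (simp add: q_def mult_le_0_iff)
      then have "(0, 1) \<in> S" by (intro mem) auto
      from lower[OF this] have "Inf (J ` S) \<le> 0"
        using \<open>G = 0\<close> by (simp add: J)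
      then have "1 / (4 * P) * Inf (J ` S) \<le> 0"
        using P by (simp add: divide_nonpos_pos)
      then show ?thesis
        using True \<open>G = 0\<close> by auto
    next
      case False
      then have A: "A > 0" and B: "B > 0" using A0 B0 by auto
      \<comment> \<open>The minimiser of B / \<beta> + \<beta> A, at which both summands equal sqrt
        A * sqrt B.\<close>
      define \<beta> where "\<beta> = sqrt B / sqrt A"
      have be: "\<beta> > 0" using A B by (simp add: \<beta>_def)
      have opt: "B / \<beta> = sqrt A * sqrt B" "\<beta> * A = sqrt A * sqrt B"
        using A B real_sqrt_mult_self[of A] real_sqrt_mult_self[of B] unfolding \<beta>_def
        by (simp_all add: field_simps)
      \<comment> \<open>The constraint fixes \<alpha> up to sign; the sign of
        \<open>I \<beta>\<close> is taken, so that \<alpha> g points towards the projection of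
        u.\<close>
      define r where "r = sqrt (G / Y \<beta>)"
      define \<alpha> where "\<alpha> = (if I \<beta> \<ge> 0 then r else - r)"
      have Y: "Y \<beta> > 0" by (rule Y0[OF be])
      have r2: "r\<^sup>2 = G / Y \<beta>" unfolding r_def using G0 Y by simp
      then have \<alpha>2: "G = \<alpha>\<^sup>2 * Y \<beta>" using Y by (simp add: \<alpha>_def)
      have \<alpha>I: "\<alpha> * I \<beta> = r * \<bar>I \<beta>\<bar>" by (simp add: \<alpha>_def)
      have "\<bar>I \<beta>\<bar> \<le> r * Y \<beta>"
      proof -
        have "(r * Y \<beta>)\<^sup>2 = G * Y \<beta>"
          unfolding power_mult_distrib r2 using Y by (simp add: power2_eq_square)
        then have "\<bar>I \<beta>\<bar>\<^sup>2 \<le> (r * Y \<beta>)\<^sup>2"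
          using cross(2)[OF be] by simp
        then show ?thesis
          by (rule power2_le_imp_le) (use Y G0 in \<open>simp add: r_def\<close>)
      qed
      then have "\<bar>I \<beta>\<bar> * \<bar>I \<beta>\<bar> \<le> \<bar>I \<beta>\<bar> * (r * Y \<beta>)"
        by (rule mult_left_mono) simp
      \<comment> \<open>By Cauchy-Schwarz the projection is no longer than u, so lengthening it to
        the norm of u only increases the inner product with u. This yields the factor 2 against the
        distance to the line.\<close>
      then have "(I \<beta>)\<^sup>2 / Y \<beta> \<le> \<alpha> * I \<beta>"
        unfolding \<alpha>I using Y by (simp add: field_simps power2_eq_square)
      have "Inf (J ` S) \<le> J (\<alpha>, \<beta>)"
        by (intro lower mem be \<alpha>2)
      also have "\<dots> = 2 * (G - \<alpha> * I \<beta>)"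
        unfolding J[OF be] using \<alpha>2 by simp
      also have "\<dots> \<le> 2 * (G - (I \<beta>)\<^sup>2 / Y \<beta>)"
        using \<open>(I \<beta>)\<^sup>2 / Y \<beta> \<le> \<alpha> * I \<beta>\<close> by simp
      also have "\<dots> \<le> 2 * (P * (B / \<beta> + \<beta> * A - (N - a - b - 1) * G))"
        using le[OF be] by simp
      also have "\<dots> = 4 * P * (sqrt A * sqrt B - (N - a - b - 1) / 2 * G)"
        unfolding opt by (simp add: field_simps)
      finally show ?thesis
        using P by (simp add: pos_divide_le_eq mult.commute)
    qed
    then show ?thesis unfolding goal .
  qed
  moreover have "1 / (4 * P) > 0" using P by simp
  ultimately show ?thesis by blast
qed

end
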